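(* Let $G=(\mathcal{A}\cup\mathcal{B},E)$ be a bipartite graph in which every vertex $v\in\mathcal{A}\cup\mathcal{B}$ has a lower quota $q^-(v)\in\mathbb{Z}_{\ge 0}$, an upper quota $q^+(v)\in\mathbb{Z}_{>0}$ with $q^-(v)\le q^+(v)$, and a strict preference ordering over its neighbors. Then there is a polynomial-time algorithm that computes a matching $M$ of $G$ which is critical, is popular in the set of critical matchings of $G$, and has maximum size among all matchings of $G$ that are popular in the set of critical matchings. (In particular, a matching that is popular in the set of critical matchings always exists.)
   Context: A matching in $G$ is a set $M\subseteq E$ with $|M(v)|\le q^+(v)$ for every vertex $v$, where $M(v)$ is the set of neighbors of $v$ assigned to $v$ in $M$. The deficiency of $v$ in $M$ is $\max\{0,q^-(v)-|M(v)|\}$, and the deficiency $\mathrm{Def}(M)$ of $M$ is the sum of the deficiencies of all vertices. A matching $M$ is critical if no matching $N$ of $G$ has $\mathrm{Def}(N)<\mathrm{Def}(M)$. The size of a matching is its number of edges. Voting: to compare matchings $M$ and $N$, each vertex $v$ pads $M(v)$ and $N(v)$ with copies of a symbol $\bot$ so that both have $q^+(v)$ elements; $v$ prefers every neighbor to $\bot$ and is indifferent among copies of $\bot$. Vertex $v$ chooses an arbitrary bijection $\mathrm{corr}_v$ from $M(v)\setminus N(v)$ to $N(v)\setminus M(v)$ (these padded sets have equal size). For $u\in M(v)\setminus N(v)$ with $u'=\mathrm{corr}_v(u)$, $v$'s vote is $+1$ if $v$ prefers $u$ to $u'$, $-1$ if it prefers $u'$ to $u$, and $0$ otherwise; $\mathrm{vote}_v(M,N,\mathrm{corr}_v)$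 is the sum of these votes. With $\mathrm{corr}$ the collection of all $\mathrm{corr}_v$, let $\Delta(M,N,\mathrm{corr})=\sum_{v\in\mathcal{A}\cup\mathcal{B}}\mathrm{vote}_v(M,N,\mathrm{corr}_v)$. A matching $N$ is more popular than $M$ under $\mathrm{corr}$ if $\Delta(N,M,\mathrm{corr})>0$. A matching $M$ is popular in a set $\mathcal{S}$ of matchings (with $M\in\mathcal{S}$) if there is no $N\in\mathcal{S}$ and no choice of $\mathrm{corr}$ under which $N$ is more popular than $M$. *)

theory Defs
  imports "HOL-Library.Log_Nat" "HOL-Computational_Algebra.Polynomial"
begin

section \<open>Bipartite graphs with two-sided quotas and preferences\<close>

text \<open>The strict preference ordering of a vertex over its neighbours is the list of its
  neighbours, without repetition, most preferred first.\<close>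

record 'v quota_graph =
  sideA :: "'v set"
  sideB :: "'v set"
  edges :: "('v \<times> 'v) set"
  lquota :: "'v \<Rightarrow> nat"
  uquota :: "'v \<Rightarrow> nat"
  prefs :: "'v \<Rightarrow> 'v list"

definition verts :: "'v quota_graph \<Rightarrow> 'v set" where
  "verts G = sideA G \<union> sideB G"

definition nbrs :: "('v \<times> 'v) set \<Rightarrow> 'v \<Rightarrow> 'v set" where
  "nbrs M v = {u. (v, u) \<in> M \<or> (u, v) \<in> M}"

definition bipartite_quota_graph :: "'v quota_graph \<Rightarrow> bool" where
  "bipartite_quota_graph G \<longleftrightarrow>
     finite (sideA G) \<and> finite (sideB G) \<and> sideA G \<inter> sideB G = {} \<and>
     edges G \<subseteq> sideA G \<times> sideB G \<and>
     (\<forall>v\<in>verts G. 0 < uquota G v \<and> lquota G v \<le> uquota G v \<and>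
        distinct (prefs G v) \<and> set (prefs G v) = nbrs (edges G) v)"

definition prefers :: "'v quota_graph \<Rightarrow> 'v \<Rightarrow> 'v \<Rightarrow> 'v \<Rightarrow> bool" where
  "prefers G v u u' \<longleftrightarrow>
     (\<exists>i j. i < j \<and> j < length (prefs G v) \<and> prefs G v ! i = u \<and> prefs G v ! j = u')"


section \<open>Matchings and criticality\<close>

definition matching :: "'v quota_graph \<Rightarrow> ('v \<times> 'v) set \<Rightarrow> bool" where
  "matching G M \<longleftrightarrow> M \<subseteq> edges G \<and> (\<forall>v\<in>verts G. card (nbrs M v) \<le> uquota G v)"

text \<open>Subtraction on \<^typ>\<open>nat\<close> is truncated, so the summand is
  \<open>max {0, q\<^sup>-(v) - |M(v)|}\<close>.\<close>

definition deficiency :: "'v quota_graph \<Rightarrow> ('v \<times> 'v) set \<Rightarrow> nat" where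
  "deficiency G M = (\<Sum>v\<in>verts G. lquota G v - card (nbrs M v))"

definition critical :: "'v quota_graph \<Rightarrow> ('v \<times> 'v) set \<Rightarrow> bool" where
  "critical G M \<longleftrightarrow>
     matching G M \<and> \<not> (\<exists>N. matching G N \<and> deficiency G N < deficiency G M)"


section \<open>Voting and popularity\<close>

text \<open>The copies of \<open>\<bottom>\<close> are numbered from 0, so that copies occurring in both padded sets
  cancel in the set difference, just as common neighbours do.\<close>

datatype 'v slot = Nbr 'v | Bot nat

definition padded :: "'v quota_graph \<Rightarrow> ('v \<times> 'v) set \<Rightarrow> 'v \<Rightarrow> 'v slot set" where
  "padded G M v = Nbr ` nbrs M v \<union> Bot ` {..<uquota G v - card (nbrs M v)}"

fun slot_prefers :: "'v quota_graph \<Rightarrow> 'v \<Rightarrow> 'v slot \<Rightarrow> 'v slot \<Rightarrow> bool" where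
  "slot_prefers G v (Nbr u) (Nbr u') \<longleftrightarrow> prefers G v u u'"
| "slot_prefers G v (Nbr u) (Bot j) \<longleftrightarrow> True"
| "slot_prefers G v (Bot i) y \<longleftrightarrow> False"

type_synonym 'v correspondence = "'v \<Rightarrow> 'v slot \<Rightarrow> 'v slot"

definition valid_corr ::
  "'v quota_graph \<Rightarrow> ('v \<times> 'v) set \<Rightarrow> ('v \<times> 'v) set \<Rightarrow> 'v correspondence \<Rightarrow> bool" where
  "valid_corr G M N corr \<longleftrightarrow>
     (\<forall>v\<in>verts G. bij_betw (corr v) (padded G M v - padded G N v) (padded G N v - padded G M v))"

definition vote ::
  "'v quota_graph \<Rightarrow> 'v \<Rightarrow> ('v \<times> 'v) set \<Rightarrow> ('v \<times> 'v) set \<Rightarrow> ('v slot \<Rightarrow> 'v slot) \<Rightarrow> int" where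
  "vote G v M N corr_v =
     (\<Sum>x\<in>padded G M v - padded G N v.
        if slot_prefers G v x (corr_v x) then 1
        else if slot_prefers G v (corr_v x) x then -1
        else 0)"

definition Delta ::
  "'v quota_graph \<Rightarrow> ('v \<times> 'v) set \<Rightarrow> ('v \<times> 'v) set \<Rightarrow> 'v correspondence \<Rightarrow> int" where
  "Delta G M N corr = (\<Sum>v\<in>verts G. vote G v M N (corr v))"

definition popular_in :: "'v quota_graph \<Rightarrow> ('v \<times> 'v) set set \<Rightarrow> ('v \<times> 'v) set \<Rightarrow> bool" where
  "popular_in G S M \<longleftrightarrow>
     M \<in> S \<and> \<not> (\<exists>N\<in>S. \<exists>corr. valid_corr G N M corr \<and> Delta G N M corr > 0)"

abbreviation popular_critical :: "'v quota_graph \<Rightarrow> ('v \<times> 'v) set \<Rightarrow> bool" where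
  "popular_critical G \<equiv> popular_in G {M. critical G M}"

lemma finite_nbrs: "finite M \<Longrightarrow> finite (nbrs M v)"
proof -
  assume "finite M"
  then have "finite (fst ` M \<union> snd ` M)" by simp
  moreover have "nbrs M v \<subseteq> fst ` M \<union> snd ` M"
    by (force simp: nbrs_def)
  ultimately show ?thesis by (rule rev_finite_subset)
qed

lemma card_padded:
  assumes "bipartite_quota_graph G" "matching G M" "v \<in> verts G"
  shows "card (padded G M v) = uquota G v"
proof -
  have "finite M"
    using assms(1,2) unfolding bipartite_quota_graph_def matching_def
    by (meson finite_SigmaI finite_subset)
  then have "finite (nbrs M v)" by (rule finite_nbrs)
  then have "card (padded G M v) = card (nbrs M v) + (uquota G v - card (nbrs M v))"
    unfolding padded_def
    by (subst card_Un_disjoint) (auto simp: card_image inj_on_def)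
  then show ?thesis
    using assms(2,3) by (simp add: matching_def)
qed


section \<open>Random access machines\<close>

text \<open>
  The model of computation is a unit-cost random access machine, presented as a while
  language.  A program has finitely many registers (indexed by \<^typ>\<open>nat\<close>), each an array of
  natural numbers; a scalar variable is cell 0 of a register.  Addition and truncated
  subtraction are the only arithmetic operations.  In particular there is no multiplication,
  so within \<open>t\<close> steps only numbers of \<open>O(t + n)\<close> bits can be produced from inputs of \<open>n\<close> bits,
  and polynomial time here coincides with polynomial time on Turing machines.
\<close>

type_synonym state = "nat \<Rightarrow> nat \<Rightarrow> nat"

datatype aexp = Const nat | Cell nat aexp | Plus aexp aexp | Minus aexp aexp

datatype bexp = Less aexp aexp | Not bexp | And bexp bexp

datatype com =
    Skip
  | Assign nat aexp aexp
  | Seq com com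
  | If bexp com com
  | While bexp com

primrec aval :: "aexp \<Rightarrow> state \<Rightarrow> nat" where
  "aval (Const n) s = n"
| "aval (Cell r e) s = s r (aval e s)"
| "aval (Plus d e) s = aval d s + aval e s"
| "aval (Minus d e) s = aval d s - aval e s"

primrec bval :: "bexp \<Rightarrow> state \<Rightarrow> bool" where
  "bval (Less d e) s \<longleftrightarrow> aval d s < aval e s"
| "bval (Not b) s \<longleftrightarrow> \<not> bval b s"
| "bval (And b c) s \<longleftrightarrow> bval b s \<and> bval c s"

definition update :: "state \<Rightarrow> nat \<Rightarrow> nat \<Rightarrow> nat \<Rightarrow> state" where
  "update s r i x = s(r := (s r)(i := x))"

text \<open>\<open>exec c s t s'\<close>: started in \<open>s\<close>, the program \<open>c\<close> halts in \<open>s'\<close> after \<open>t\<close> steps.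
  Expressions are evaluated in one step; as they are part of the fixed program, this changes
  running times by a constant factor only.\<close>

inductive exec :: "com \<Rightarrow> state \<Rightarrow> nat \<Rightarrow> state \<Rightarrow> bool" where
  Skip: "exec Skip s 1 s"
| Assign: "exec (Assign r d e) s 1 (update s r (aval d s) (aval e s))"
| Seq: "exec c1 s1 t1 s2 \<Longrightarrow> exec c2 s2 t2 s3 \<Longrightarrow> exec (Seq c1 c2) s1 (t1 + t2) s3"
| IfTrue: "bval b s \<Longrightarrow> exec c1 s t s' \<Longrightarrow> exec (If b c1 c2) s (t + 1) s'"
| IfFalse: "\<not> bval b s \<Longrightarrow> exec c2 s t s' \<Longrightarrow> exec (If b c1 c2) s (t + 1) s'"
| WhileFalse: "\<not> bval b s \<Longrightarrow> exec (While b c) s 1 s"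
| WhileTrue: "bval b s1 \<Longrightarrow> exec c s1 t1 s2 \<Longrightarrow> exec (While b c) s2 t2 s3 \<Longrightarrow>
    exec (While b c) s1 (t1 + t2 + 1) s3"

inductive_cases exec_SkipE: "exec Skip s t s'"
inductive_cases exec_AssignE: "exec (Assign r d e) s t s'"
inductive_cases exec_SeqE: "exec (Seq c1 c2) s t s'"
inductive_cases exec_IfE: "exec (If b c1 c2) s t s'"
inductive_cases exec_WhileE: "exec (While b c) s t s'"

lemma exec_deterministic:
  "exec c s t s' \<Longrightarrow> exec c s u s'' \<Longrightarrow> t = u \<and> s' = s''"
proof (induction arbitrary: u s'' rule: exec.induct)
  case (Seq c1 s1 t1 s2 c2 t2 s3)
  from Seq.prems obtain u1 u2 r where "exec c1 s1 u1 r" "exec c2 r u2 s''" "u = u1 + u2"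
    by (rule exec_SeqE)
  then show ?case using Seq.IH by metis
next
  case (IfTrue b s c1 t s' c2)
  from IfTrue.prems IfTrue.hyps obtain u' where "exec c1 s u' s''" "u = u' + 1"
    by (auto elim: exec_IfE)
  then show ?case using IfTrue.IH by metis
next
  case (IfFalse b s c2 t s' c1)
  from IfFalse.prems IfFalse.hyps obtain u' where "exec c2 s u' s''" "u = u' + 1"
    by (auto elim: exec_IfE)
  then show ?case using IfFalse.IH by metis
next
  case (WhileFalse b s c)
  from WhileFalse.prems show ?case
    by (rule exec_WhileE) (simp_all add: WhileFalse.hyps)
next
  case (WhileTrue b s1 c t1 s2 t2 s3)
  from WhileTrue.prems obtain u1 u2 r
    where "exec c s1 u1 r" "exec (While b c) r u2 s''" "u = u1 + u2 + 1"
    by (rule exec_WhileE) (simp_all add: WhileTrue.hyps)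
  then show ?case using WhileTrue.IH by metis
qed (auto elim: exec_SkipE exec_AssignE)

text \<open>The input list is placed in register 0 and the output list is read off register 1, each
  preceded by its length; all other cells are initially 0.\<close>

definition init_state :: "nat list \<Rightarrow> state" where
  "init_state xs = (\<lambda>r i.
     if r = 0 \<and> i = 0 then length xs
     else if r = 0 \<and> i \<le> length xs then xs ! (i - 1)
     else 0)"

definition read_output :: "state \<Rightarrow> nat list" where
  "read_output s = map (s 1) [1..<Suc (s 1 0)]"

text \<open>Number of symbols needed to write down the list in binary, with one separator per entry;
  \<^term>\<open>floorlog 2 x\<close> is the number of binary digits of \<open>x\<close>.\<close>

definition bit_size :: "nat list \<Rightarrow> nat" where
  "bit_size xs = (\<Sum>x\<leftarrow>xs. 1 + floorlog 2 x)"

text \<open>The program \<open>c\<close> runs in time polynomial in the length of the encoded instance and, on every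
  instance in \<open>I\<close>, its output encodes a solution of that instance.  Encodings of solutions need
  not be unique.\<close>

definition solves_in_polynomial_time ::
  "('i \<Rightarrow> nat list) \<Rightarrow> (nat list \<Rightarrow> 's \<Rightarrow> bool) \<Rightarrow> 'i set \<Rightarrow> ('i \<Rightarrow> 's \<Rightarrow> bool) \<Rightarrow> com \<Rightarrow> bool" where
  "solves_in_polynomial_time enc out_enc I sol c \<longleftrightarrow>
     (\<exists>p :: nat poly. \<forall>x\<in>I. \<exists>t s y.
        exec c (init_state (enc x)) t s \<and> t \<le> poly p (bit_size (enc x)) \<and>
        out_enc (read_output s) y \<and> sol x y)"


section \<open>Encodings\<close>

text \<open>As machine inputs, graphs have natural numbers as names of their vertices.  For each vertex
  the encoding lists its name, quotas, degree and preference list; the edges are determined by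
  the preference lists.\<close>

definition encode_vertex :: "nat quota_graph \<Rightarrow> nat \<Rightarrow> nat list" where
  "encode_vertex G v = [v, lquota G v, uquota G v, length (prefs G v)] @ prefs G v"

definition encode_graph :: "nat quota_graph \<Rightarrow> nat list" where
  "encode_graph G = [card (sideA G), card (sideB G)] @
     concat (map (encode_vertex G)
       (sorted_list_of_set (sideA G) @ sorted_list_of_set (sideB G)))"

text \<open>An edge set is output as a list of its edges, without repetition and in any order.\<close>

definition encodes_edges :: "nat list \<Rightarrow> (nat \<times> nat) set \<Rightarrow> bool" where
  "encodes_edges xs M \<longleftrightarrow>
     (\<exists>es. distinct es \<and> set es = M \<and> xs = concat (map (\<lambda>(a, b). [a, b]) es))"

end

theory Submission
  imports Defs
begin

text \<open>
  Every matching edge \<open>(a, b)\<close> carries a level in \<open>{0..<2 * T}\<close>; \<open>a\<close> likes low levels, \<open>b\<close> likes high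
  ones, and preferences only break ties.  Levels above \<open>T\<close> (for \<open>a\<close>) and below \<open>T - 1\<close> (for \<open>b\<close>) may
  only be used while the vertex has no more than \<open>q\<^sup>-\<close> partners.  Suppose \<open>M\<close> is stable with respect to these
  levels.  Reading levels as potentials of the slots, the two votes of an edge of \<open>N - M\<close> are bounded by
  the sum of the potentials of the slots it displaces, while the two potentials of an edge of \<open>M\<close>
  cancel.  Summing up, \<open>\<Delta>(N, M) \<le> (2 * T - 2) * (Def N - Def M) - g\<close>, where \<open>g\<close> is the total number
  of partners gained by vertices in passing from \<open>M\<close> to \<open>N\<close>.  This gives popularity among critical
  matchings and maximality of the size at once; and since \<open>\<Delta>\<close> is at least \<open>-4 * |E|\<close>, it also
  gives criticality as soon as \<open>T\<close> is large.  A stable \<open>M\<close> is found by deferred acceptance: each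
  rejection raises the level of one edge.
\<close>

section \<open>Level-stable matchings\<close>

text \<open>The correspondences are arbitrary, so an edge of \<open>N - M\<close> may be set against
  any slot of \<open>M\<close> at its ends; every estimate therefore has to hold slot by slot, for
  the best partner as well as for the worst. This is why stability is required at every level at
  which a missing edge could be inserted, and not just at one. The constants come from the shape of
  the scale. The levels of the two ends add up to the odd number \<open>2 * T - 1\<close>, so
  exactly the two middle levels are open to the upper quotas of both ends. An ordinary empty slot
  sits at level \<open>T\<close> and is worth -1 instead of 0; this unit is the origin of
  \<open>g\<close>. A slot that counts towards the deficiency sits at the last level and is worth
  \<open>2 * T - 2\<close> less, which is the factor of \<open>Def N - Def M\<close>. Quotas may be
  exponential in the length of the input, so neither \<open>T\<close> nor the running time may
  depend on their values; bounding \<open>Delta\<close> by the number of edges is what keeps the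
  number of levels polynomial.\<close>

definition strict_linear_on :: "'a set \<Rightarrow> ('a \<Rightarrow> 'a \<Rightarrow> bool) \<Rightarrow> bool" where
  "strict_linear_on S r \<longleftrightarrow> (\<forall>x\<in>S. \<not> r x x) \<and>
     (\<forall>x\<in>S. \<forall>y\<in>S. \<forall>z\<in>S. r x y \<longrightarrow> r y z \<longrightarrow> r x z) \<and>
     (\<forall>x\<in>S. \<forall>y\<in>S. x \<noteq> y \<longrightarrow> r x y \<or> r y x)"

lemma rank_less:
  assumes fin: "finite S" and lin: "strict_linear_on S r" and xy: "x \<in> S" "y \<in> S" "r x y"
  shows "card {z \<in> S. r z x} < card {z \<in> S. r z y}"
proof (rule psubset_card_mono)
  have "\<not> r x x" using lin xy by (simp add: strict_linear_on_def)
  then have "x \<in> {z \<in> S. r z y}" "x \<notin> {z \<in> S. r z x}"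
    using xy by auto
  moreover have "{z \<in> S. r z x} \<subseteq> {z \<in> S. r z y}"
    using lin xy unfolding strict_linear_on_def by blast
  ultimately show "{z \<in> S. r z x} \<subset> {z \<in> S. r z y}" by blast
qed (use fin in simp)

lemma bij_betw_rank:
  assumes fin: "finite S" and lin: "strict_linear_on S r"
  shows "bij_betw (\<lambda>x. card {z \<in> S. r z x}) S {..<card S}"
proof -
  let ?f = "\<lambda>x. card {z \<in> S. r z x}"
  have "inj_on ?f S"
  proof (rule inj_onI, rule ccontr)
    fix x y assume xy: "x \<in> S" "y \<in> S" "?f x = ?f y" "x \<noteq> y"
    then have "r x y \<or> r y x" using lin by (simp add: strict_linear_on_def)
    then show False using rank_less[OF fin lin, of x y] rank_less[OF fin lin, of y x] xy by auto
  qed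
  moreover have "?f ` S \<subseteq> {..<card S}"
  proof (rule image_subsetI)
    fix x assume x: "x \<in> S"
    then have "\<not> r x x" using lin by (simp add: strict_linear_on_def)
    with x have "{z \<in> S. r z x} \<subset> S" by blast
    then show "?f x \<in> {..<card S}" using fin by (simp add: psubset_card_mono)
  qed
  ultimately show ?thesis
    by (simp add: bij_betw_def card_image card_subset_eq)
qed

text \<open>The ranks fill \<open>{..<card S}\<close> without gaps, so a larger set would contain an
  element of rank \<open>k\<close>. This turns the capacity condition on each single partner into a
  bound on the number of partners.\<close>

lemma card_le_if_ranks_less:
  assumes "finite S" "strict_linear_on S r" "\<And>x. x \<in> S \<Longrightarrow> card {z \<in> S. r z x} < k"
  shows "card S \<le> k"
proof (rule ccontr)
  assume "\<not> card S \<le> k"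
  then have "k \<in> (\<lambda>x. card {z \<in> S. r z x}) ` S"
    using bij_betw_rank[OF assms(1,2)] by (auto simp: bij_betw_def)
  then show False using assms(3) by auto
qed

lemma card_ranks_less:
  assumes fin: "finite S" and lin: "strict_linear_on S r" and k: "k \<le> card S"
  shows "card {x \<in> S. card {z \<in> S. r z x} < k} = k"
proof -
  let ?f = "\<lambda>x. card {z \<in> S. r z x}"
  have bij: "bij_betw ?f S {..<card S}" by (rule bij_betw_rank[OF fin lin])
  have "?f ` {x \<in> S. ?f x < k} = {..<k}"
  proof
    show "{..<k} \<subseteq> ?f ` {x \<in> S. ?f x < k}"
    proof
      fix i assume i: "i \<in> {..<k}"
      then have "i \<in> ?f ` S" using bij k by (auto simp: bij_betw_def)
      then show "i \<in> ?f ` {x \<in> S. ?f x < k}" using i by auto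
    qed
  qed auto
  moreover have "inj_on ?f {x \<in> S. ?f x < k}"
    using bij unfolding bij_betw_def by (blast intro: inj_on_subset)
  then have "card (?f ` {x \<in> S. ?f x < k}) = card {x \<in> S. ?f x < k}" by (rule card_image)
  ultimately show ?thesis by simp
qed

text \<open>Both ends like low levels on their own scale. The taste of \<open>b\<close> for high
  levels arises only because \<open>b\<close> reads level \<open>l\<close> of the edge as
  \<open>2 * T - 1 - l\<close>.\<close>

definition better :: "'v quota_graph \<Rightarrow> 'v \<Rightarrow> nat \<Rightarrow> 'v \<Rightarrow> nat \<Rightarrow> 'v \<Rightarrow> bool" where
  "better G v l' u' l u \<longleftrightarrow> l' < l \<or> l' = l \<and> prefers G v u' u"

text \<open>Of the two levels \<open>l\<close> and \<open>2 * T - 1 - l\<close> of an edge, both are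
  at most \<open>T\<close> only for \<open>l = T - 1\<close> and \<open>l = T\<close>; at any other
  level one end is restricted to its lower quota.\<close>

definition capacity :: "'v quota_graph \<Rightarrow> nat \<Rightarrow> 'v \<Rightarrow> nat \<Rightarrow> nat" where
  "capacity G T v l = (if l \<le> T then uquota G v else lquota G v)"

section \<open>Preferences, neighbourhoods and sums over edges\<close>

locale quota_instance =
  fixes G :: "'v quota_graph"
  assumes bip: "bipartite_quota_graph G"
begin

lemma finite_verts: "finite (verts G)"
  using bip by (simp add: bipartite_quota_graph_def verts_def)

lemma finite_edges: "finite (edges G)"
  using bip unfolding bipartite_quota_graph_def by (meson finite_SigmaI finite_subset)

lemma edge_sides: "(a, b) \<in> edges G \<Longrightarrow> a \<in> sideA G \<and> b \<in> sideB G"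
  using bip by (auto simp: bipartite_quota_graph_def)

lemma edge_verts: "(a, b) \<in> edges G \<Longrightarrow> a \<in> verts G \<and> b \<in> verts G"
  using edge_sides by (auto simp: verts_def)

lemma sides_disjoint: "sideA G \<inter> sideB G = {}"
  using bip by (auto simp: bipartite_quota_graph_def)

lemma lquota_le_uquota: "v \<in> verts G \<Longrightarrow> lquota G v \<le> uquota G v"
  and distinct_prefs: "v \<in> verts G \<Longrightarrow> distinct (prefs G v)"
  and set_prefs: "v \<in> verts G \<Longrightarrow> set (prefs G v) = nbrs (edges G) v"
  using bip by (auto simp: bipartite_quota_graph_def)

lemma prefers_nth_iff:
  assumes "v \<in> verts G" "i < length (prefs G v)" "j < length (prefs G v)"
  shows "prefers G v (prefs G v ! i) (prefs G v ! j) \<longleftrightarrow> i < j"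
  using assms distinct_prefs[OF assms(1)] unfolding prefers_def
  by (metis nth_eq_iff_index_eq order.strict_trans)

lemma prefers_irrefl: "v \<in> verts G \<Longrightarrow> \<not> prefers G v u u"
  using distinct_prefs nth_eq_iff_index_eq by (fastforce simp: prefers_def)

lemma prefers_trans:
  assumes "v \<in> verts G" "prefers G v u u'" "prefers G v u' u''"
  shows "prefers G v u u''"
  using assms distinct_prefs[OF assms(1)] unfolding prefers_def
  by (metis nth_eq_iff_index_eq order.strict_trans)

lemma prefers_asym: "v \<in> verts G \<Longrightarrow> prefers G v u u' \<Longrightarrow> \<not> prefers G v u' u"
  using prefers_trans prefers_irrefl by blast

lemma prefers_total:
  assumes "v \<in> verts G" "u \<in> nbrs (edges G) v" "u' \<in> nbrs (edges G) v" "u \<noteq> u'"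
  shows "prefers G v u u' \<or> prefers G v u' u"
proof -
  obtain i j where "i < length (prefs G v)" "j < length (prefs G v)"
    "u = prefs G v ! i" "u' = prefs G v ! j"
    using assms set_prefs[OF assms(1)] by (metis in_set_conv_nth)
  then show ?thesis
    using prefers_nth_iff[OF assms(1)] \<open>u \<noteq> u'\<close> by (metis linorder_neqE_nat)
qed

lemma nbrs_sideA: "F \<subseteq> edges G \<Longrightarrow> a \<in> sideA G \<Longrightarrow> nbrs F a = {b. (a, b) \<in> F}"
  and nbrs_sideB: "F \<subseteq> edges G \<Longrightarrow> b \<in> sideB G \<Longrightarrow> nbrs F b = {a. (a, b) \<in> F}"
  using edge_sides sides_disjoint by (fastforce simp: nbrs_def)+

lemma finite_nbrs_edges: "F \<subseteq> edges G \<Longrightarrow> finite (nbrs F v)"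
  by (meson finite_edges finite_nbrs finite_subset)

text \<open>\<open>nbrs\<close> ignores the orientation of pairs, so for arbitrary relations this
  fails when \<open>F\<close> has a pair and \<open>H\<close> its reverse. The disjoint sides
  exclude that.\<close>

lemma nbrs_diff:
  assumes "F \<subseteq> edges G" "H \<subseteq> edges G" "v \<in> verts G"
  shows "nbrs (F - H) v = nbrs F v - nbrs H v"
proof (cases "v \<in> sideA G")
  case True
  then show ?thesis using assms by (subst (1 2 3) nbrs_sideA) auto
next
  case False
  then have "v \<in> sideB G" using assms(3) by (simp add: verts_def)
  then show ?thesis using assms by (subst (1 2 3) nbrs_sideB) auto
qed

text \<open>Double counting: every edge is met once from each end. It regroups votes and potentials,
  which are collected by vertex, into pairs belonging to one edge.\<close>

lemma sum_nbrs:
  fixes f :: "'v \<Rightarrow> 'v \<Rightarrow> 'c :: comm_monoid_add"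
  assumes F: "F \<subseteq> edges G"
  shows "(\<Sum>v\<in>verts G. \<Sum>u\<in>nbrs F v. f v u) = (\<Sum>(a, b)\<in>F. f a b + f b a)"
proof -
  have fin: "finite (sideA G)" "finite (sideB G)"
    using bip by (auto simp: bipartite_quota_graph_def)
  have A: "(\<Sum>v\<in>sideA G. \<Sum>u\<in>nbrs F v. f v u) = (\<Sum>(a, b)\<in>F. f a b)"
  proof -
    have "(\<Sum>v\<in>sideA G. \<Sum>u\<in>nbrs F v. f v u) = (\<Sum>(a, b)\<in>Sigma (sideA G) (nbrs F). f a b)"
      by (rule sum.Sigma) (auto simp: fin finite_nbrs_edges[OF F])
    also have "Sigma (sideA G) (nbrs F) = F"
      using F edge_sides by (auto simp: nbrs_sideA[OF F])
    finally show ?thesis .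
  qed
  have B: "(\<Sum>v\<in>sideB G. \<Sum>u\<in>nbrs F v. f v u) = (\<Sum>(a, b)\<in>F. f b a)"
  proof -
    have swap: "prod.swap ` F = {(b, a). (a, b) \<in> F}"
      by force
    have "(\<Sum>v\<in>sideB G. \<Sum>u\<in>nbrs F v. f v u) = (\<Sum>(b, a)\<in>Sigma (sideB G) (nbrs F). f b a)"
      by (rule sum.Sigma) (auto simp: fin finite_nbrs_edges[OF F])
    also have "Sigma (sideB G) (nbrs F) = prod.swap ` F"
      unfolding swap using F edge_sides by (auto simp: nbrs_sideB[OF F])
    also have "(\<Sum>(b, a)\<in>prod.swap ` F. f b a) = (\<Sum>(a, b)\<in>F. f b a)"
      by (subst sum.reindex) (auto simp: case_prod_unfold)
    finally show ?thesis .
  qed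
  have "(\<Sum>v\<in>verts G. \<Sum>u\<in>nbrs F v. f v u)
      = (\<Sum>v\<in>sideA G. \<Sum>u\<in>nbrs F v. f v u) + (\<Sum>v\<in>sideB G. \<Sum>u\<in>nbrs F v. f v u)"
    unfolding verts_def by (rule sum.union_disjoint) (auto simp: fin sides_disjoint)
  then show ?thesis
    by (simp add: A B sum.distrib case_prod_unfold)
qed

lemma sum_card_nbrs: "F \<subseteq> edges G \<Longrightarrow> (\<Sum>v\<in>verts G. card (nbrs F v)) = 2 * card F"
  using sum_nbrs[of F "\<lambda>_ _. 1 :: nat"] by simp

lemma better_trans:
  "v \<in> verts G \<Longrightarrow> better G v l1 u1 l2 u2 \<Longrightarrow> better G v l2 u2 l3 u3 \<Longrightarrow> better G v l1 u1 l3 u3"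
  using prefers_trans[of v u1 u2 u3] by (auto simp: better_def)

lemma strict_linear_better:
  assumes v: "v \<in> verts G" and S: "S \<subseteq> nbrs (edges G) v"
  shows "strict_linear_on S (\<lambda>u' u. better G v (l u') u' (l u) u)"
  unfolding strict_linear_on_def
proof (intro conjI ballI impI)
  fix u assume "u \<in> S" then show "\<not> better G v (l u) u (l u) u"
    using prefers_irrefl[OF v] by (simp add: better_def)
next
  fix u u' assume "u \<in> S" "u' \<in> S" "u \<noteq> u'"
  then have "prefers G v u u' \<or> prefers G v u' u" using prefers_total[OF v] S by blast
  then show "better G v (l u) u (l u') u' \<or> better G v (l u') u' (l u) u"
    by (auto simp: better_def)
qed (use better_trans[OF v] in blast)

lemma capacity_antimono: "v \<in> verts G \<Longrightarrow> l \<le> l' \<Longrightarrow> capacity G T v l' \<le> capacity G T v l"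
  by (auto simp: capacity_def lquota_le_uquota)

section \<open>Padded sets, correspondences and crude bounds on \<open>Delta\<close>\<close>

lemma finite_padded: "M \<subseteq> edges G \<Longrightarrow> finite (padded G M v)"
  by (simp add: padded_def finite_nbrs_edges)

lemma slot_prefers_asym: "v \<in> verts G \<Longrightarrow> slot_prefers G v x y \<Longrightarrow> \<not> slot_prefers G v y x"
  by (cases x; cases y) (auto dest: prefers_asym)

lemma card_padded_diff:
  assumes "matching G M" "matching G N" "v \<in> verts G"
  shows "card (padded G N v - padded G M v) = card (padded G M v - padded G N v)"
proof -
  have f: "finite (padded G M v)" "finite (padded G N v)"
    using assms by (auto simp: matching_def intro: finite_padded)
  have "card (padded G N v) = card (padded G M v)"
    using assms bip by (simp add: card_padded)
  then show ?thesis
    using f by (simp add: card_Diff_subset_Int Int_commute)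
qed

lemma valid_corr_exists:
  assumes "matching G M" "matching G N"
  shows "\<exists>corr. valid_corr G N M corr"
proof -
  have "\<exists>h. bij_betw h (padded G N v - padded G M v) (padded G M v - padded G N v)"
    if "v \<in> verts G" for v
    using assms that card_padded_diff
    by (intro finite_same_card_bij) (auto simp: matching_def intro: finite_padded)
  then show ?thesis
    unfolding valid_corr_def by (intro bchoice) blast
qed

text \<open>Inverting every bijection reverses each single comparison, as
  \<open>slot_prefers\<close> is asymmetric. The potential argument bounds the votes for
  \<open>N\<close> against \<open>M\<close>, while popularity of \<open>N\<close> is refuted by
  votes for \<open>M\<close> against \<open>N\<close>.\<close>

lemma Delta_inverse:
  assumes "valid_corr G N M corr"
  shows "\<exists>corr'. valid_corr G M N corr' \<and> Delta G M N corr' = - Delta G N M corr"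
proof -
  define P where "P v = padded G N v - padded G M v" for v
  define Q where "Q v = padded G M v - padded G N v" for v
  define c' where "c' v = inv_into (P v) (corr v)" for v
  have b: "bij_betw (corr v) (P v) (Q v)" if "v \<in> verts G" for v
    using assms that by (simp add: valid_corr_def P_def Q_def)
  have "valid_corr G M N c'"
    unfolding valid_corr_def c'_def P_def[symmetric] Q_def[symmetric]
    by (auto intro: bij_betw_inv_into b)
  moreover have "vote G v M N (c' v) = - vote G v N M (corr v)" if v: "v \<in> verts G" for v
  proof -
    let ?f = "\<lambda>x y. if slot_prefers G v x y then 1 else if slot_prefers G v y x then -1 else (0::int)"
    have "vote G v M N (c' v) = (\<Sum>y\<in>Q v. ?f y (c' v y))"
      by (simp add: vote_def Q_def)
    also have "\<dots> = (\<Sum>x\<in>P v. ?f (corr v x) (c' v (corr v x)))"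
      using sum.reindex_bij_betw[OF b[OF v], of "\<lambda>y. ?f y (c' v y)"] by simp
    also have "\<dots> = (\<Sum>x\<in>P v. - ?f x (corr v x))"
    proof (rule sum.cong)
      fix x assume "x \<in> P v"
      then have "c' v (corr v x) = x"
        using b[OF v] by (simp add: c'_def bij_betw_inv_into_left)
      then show "?f (corr v x) (c' v (corr v x)) = - ?f x (corr v x)"
        using slot_prefers_asym[OF v] by auto
    qed simp
    also have "\<dots> = - vote G v N M (corr v)"
      by (simp add: vote_def P_def sum_negf)
    finally show ?thesis .
  qed
  then have "Delta G M N c' = - Delta G N M corr"
    by (simp add: Delta_def sum_negf)
  ultimately show ?thesis by blast
qed

text \<open>Each compared slot costs at most one vote. A slot of \<open>N\<close> outside
  \<open>M\<close> is a neighbour in \<open>N\<close> or a copy of \<open>Bot\<close> whose number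
  is too high to occur for \<open>M\<close>, and there are at most \<open>card (nbrs M v)\<close> of
  the latter. The quotas cancel, so the bound depends on the number of edges alone.\<close>

lemma Delta_lower_bound:
  assumes M: "matching G M" and N: "matching G N"
  shows "- int (4 * card (edges G)) \<le> Delta G N M corr"
proof -
  have sub: "M \<subseteq> edges G" "N \<subseteq> edges G"
    using M N by (auto simp: matching_def)
  have "- int (card (nbrs N v) + card (nbrs M v)) \<le> vote G v N M (corr v)" if v: "v \<in> verts G" for v
  proof -
    have "padded G N v - padded G M v \<subseteq>
        Nbr ` nbrs N v \<union> Bot ` {uquota G v - card (nbrs M v)..<uquota G v - card (nbrs N v)}"
      by (auto simp: padded_def image_iff not_less)
    then have "card (padded G N v - padded G M v) \<le>
        card (Nbr ` nbrs N v \<union> Bot ` {uquota G v - card (nbrs M v)..<uquota G v - card (nbrs N v)})"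
      by (rule card_mono[rotated]) (simp add: finite_nbrs_edges sub)
    also have "\<dots> \<le> card (nbrs N v) + card {uquota G v - card (nbrs M v)..<uquota G v - card (nbrs N v)}"
      by (intro order.trans[OF card_Un_le] add_mono card_image_le) (auto simp: finite_nbrs_edges sub)
    also have "\<dots> \<le> card (nbrs N v) + card (nbrs M v)"
      by simp
    finally have c: "card (padded G N v - padded G M v) \<le> card (nbrs N v) + card (nbrs M v)" .
    have "(\<Sum>x\<in>padded G N v - padded G M v. - 1) \<le> vote G v N M (corr v)"
      unfolding vote_def by (rule sum_mono) auto
    then show ?thesis using c by simp
  qed
  then have "(\<Sum>v\<in>verts G. - int (card (nbrs N v) + card (nbrs M v))) \<le> Delta G N M corr"
    unfolding Delta_def by (rule sum_mono)
  moreover have "(\<Sum>v\<in>verts G. int (card (nbrs N v) + card (nbrs M v))) = int (2 * card N + 2 * card M)"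
    using sum_card_nbrs[OF sub(1)] sum_card_nbrs[OF sub(2)]
    by (simp add: sum.distrib flip: of_nat_sum)
  moreover have "card N \<le> card (edges G)" "card M \<le> card (edges G)"
    using sub by (auto intro: card_mono finite_edges)
  ultimately show ?thesis unfolding sum_negf by linarith
qed

end

text \<open>Stability, detached from the algorithm. \<open>lv v u\<close> is the level on the scale
  of \<open>v\<close>. \<open>no_blocking\<close> ranges over all levels \<open>l\<close>, so that
  the later argument may choose the level at which a missing edge is tested.\<close>

locale levelled_matching = quota_instance G for G :: "'v quota_graph" +
  fixes T :: nat and M :: "('v \<times> 'v) set" and lv :: "'v \<Rightarrow> 'v \<Rightarrow> nat"
  assumes T_pos: "0 < T"
    and matching_M: "matching G M"
    and lv_sum: "(a, b) \<in> M \<Longrightarrow> lv a b + lv b a + 1 = 2 * T"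
    and within_capacity: "v \<in> verts G \<Longrightarrow> u \<in> nbrs M v \<Longrightarrow>
      card {u' \<in> nbrs M v. better G v (lv v u') u' (lv v u) u} < capacity G T v (lv v u)"
    and no_blocking: "(a, b) \<in> edges G - M \<Longrightarrow> l < 2 * T \<Longrightarrow>
      capacity G T a l \<le> card {u' \<in> nbrs M a. better G a (lv a u') u' l b} \<or>
      capacity G T b (2 * T - 1 - l) \<le> card {u' \<in> nbrs M b. better G b (lv b u') u' (2 * T - 1 - l) a}"
begin

lemma M_edges: "M \<subseteq> edges G"
  using matching_M by (simp add: matching_def)

lemma lv_less: "u \<in> nbrs M v \<Longrightarrow> lv v u < 2 * T"
  using lv_sum by (fastforce simp: nbrs_def)

text \<open>The copies of \<open>\<bottom>\<close> with the highest numbers are the slots that count towards the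
  deficiency; they are also the first to be filled by a matching with more edges at \<open>v\<close>.\<close>

fun slot_level :: "'v \<Rightarrow> 'v slot \<Rightarrow> nat" where
  "slot_level v (Nbr u) = lv v u"
| "slot_level v (Bot i) = (if uquota G v - lquota G v \<le> i then 2 * T - 1 else T)"

text \<open>The scale is centred so that levels with sum \<open>2 * T - 1\<close> get opposite
  values. The slope 2 matches the votes of the two ends of an edge, whose sum is -2, 0 or 2.\<close>

definition slot_value :: "'v \<Rightarrow> 'v slot \<Rightarrow> int" where
  "slot_value v x = 2 * int T - 1 - 2 * int (slot_level v x)"

text \<open>There is no zero case: a new neighbour is only ever compared with a different
  slot.\<close>

definition edge_vote :: "'v \<Rightarrow> 'v \<Rightarrow> 'v slot \<Rightarrow> int" where
  "edge_vote v u x = (if slot_prefers G v (Nbr u) x then 1 else -1)"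

lemma slot_level_less: "x \<in> padded G M v \<Longrightarrow> slot_level v x < 2 * T"
  using T_pos by (auto simp: padded_def lv_less)

text \<open>If the offer of \<open>u\<close> at level \<open>l\<close> beat a partner in slot
  \<open>x\<close>, then all the partners beating that offer would beat this partner too; they are
  at least as many as its capacity, against \<open>within_capacity\<close>. If \<open>x\<close> is
  empty, \<open>v\<close> is below its upper quota, so the rejection can only come from the lower
  quota. Then \<open>T < l\<close>, the lower quota is met, and the slot is an ordinary one at level
  \<open>T\<close>.\<close>

lemma rejected_slot:
  assumes v: "v \<in> verts G" and x: "x \<in> padded G M v"
    and c: "capacity G T v l \<le> card {u' \<in> nbrs M v. better G v (lv v u') u' l u}"
  shows "slot_level v x < l \<or> slot_level v x = l \<and> edge_vote v u x = -1"
proof (cases x)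
  case (Nbr u')
  then have u': "u' \<in> nbrs M v" using x by (auto simp: padded_def)
  have "\<not> better G v l u (lv v u') u'"
  proof
    assume b: "better G v l u (lv v u') u'"
    then have "{u' \<in> nbrs M v. better G v (lv v u') u' l u}
        \<subseteq> {w \<in> nbrs M v. better G v (lv v w) w (lv v u') u'}"
      using prefers_trans[OF v] by (auto simp: better_def)
    then have "card {u' \<in> nbrs M v. better G v (lv v u') u' l u}
        \<le> card {w \<in> nbrs M v. better G v (lv v w) w (lv v u') u'}"
      by (intro card_mono) (auto simp: finite_nbrs_edges[OF M_edges])
    moreover have "capacity G T v (lv v u') \<le> capacity G T v l"
      using b v by (intro capacity_antimono) (auto simp: better_def)
    ultimately show False
      using within_capacity[OF v u'] c by simp
  qed
  then show ?thesis using Nbr by (auto simp: better_def edge_vote_def)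
next
  case (Bot i)
  then have i: "i < uquota G v - card (nbrs M v)" using x by (auto simp: padded_def)
  have c': "capacity G T v l \<le> card (nbrs M v)"
    by (rule order.trans[OF c]) (auto intro: card_mono finite_nbrs_edges[OF M_edges])
  then have "T < l" "lquota G v \<le> card (nbrs M v)"
    using i by (auto simp: capacity_def split: if_splits)
  then show ?thesis using Bot i by simp
qed

text \<open>On the scale of \<open>a\<close> the displaced slots have levels \<open>i\<close> and
  \<open>j\<close>, and the right-hand side is \<open>2 * j - 2 * i\<close>. End \<open>a\<close>
  can reject only levels from \<open>i\<close> on, and \<open>b\<close> only levels up to
  \<open>j\<close>. A level strictly between \<open>j\<close> and \<open>i\<close> would be rejected
  by nobody, so \<open>i \<le> j + 1\<close>. If \<open>i = j + 1\<close>, level \<open>i\<close>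
  forces \<open>a\<close> to vote -1 and level \<open>j\<close> forces \<open>b\<close> to; if
  \<open>i = j\<close>, one of them does; if \<open>i < j\<close>, nothing has to be shown.\<close>

lemma edge_vote_bound:
  assumes e: "(a, b) \<in> edges G - M" and x: "x \<in> padded G M a" and y: "y \<in> padded G M b"
  shows "edge_vote a b x + edge_vote b a y \<le> slot_value a x + slot_value b y"
proof -
  have v: "a \<in> verts G" "b \<in> verts G" using e edge_verts by auto
  define i where "i = slot_level a x"
  define j where "j = 2 * T - 1 - slot_level b y"
  have i: "i < 2 * T" using slot_level_less[OF x] by (simp add: i_def)
  have j: "j < 2 * T" "slot_level b y = 2 * T - 1 - j"
    using slot_level_less[OF y] T_pos by (auto simp: j_def)
  have st: "i < l \<or> i = l \<and> edge_vote a b x = -1 \<or> l < j \<or> l = j \<and> edge_vote b a y = -1"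
    if l: "l < 2 * T" for l
    using no_blocking[OF e l]
  proof
    assume "capacity G T a l \<le> card {u' \<in> nbrs M a. better G a (lv a u') u' l b}"
    from rejected_slot[OF v(1) x this] show ?thesis by (auto simp: i_def)
  next
    assume "capacity G T b (2 * T - 1 - l)
      \<le> card {u' \<in> nbrs M b. better G b (lv b u') u' (2 * T - 1 - l) a}"
    from rejected_slot[OF v(2) y this] show ?thesis using j l by auto
  qed
  have ev: "edge_vote a b x \<in> {1, -1}" "edge_vote b a y \<in> {1, -1}"
    by (auto simp: edge_vote_def)
  have val: "slot_value a x + slot_value b y = 2 * int j - 2 * int i"
    using j by (simp add: slot_value_def i_def)
  consider "j + 1 < i" | "j + 1 = i" | "j = i" | "i < j" by linarith
  then show ?thesis
  proof cases
    case 1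
    then have "i - 1 < 2 * T" "i - 1 < i" "j < i - 1" using i by auto
    then show ?thesis using st[of "i - 1"] by (metis less_asym less_irrefl)
  next
    case 2 then show ?thesis using st[of i] st[of j] i j ev val by auto
  next
    case 3 then show ?thesis using st[of i] i ev val by auto
  next
    case 4 then show ?thesis using ev val by auto
  qed
qed

section \<open>Summing the potentials over all vertices\<close>

definition stretch :: int where
  "stretch = 2 * int T - 2"

lemma slot_value_Bot:
  "slot_value v (Bot i) = (if uquota G v - lquota G v \<le> i then - 1 - stretch else - 1)"
  using T_pos by (simp add: slot_value_def stretch_def)

text \<open>The subtraction is truncated, so losses at other vertices do not offset a gain. A
  matching with more edges than \<open>M\<close> still has a positive total.\<close>

definition gain :: "('v \<times> 'v) set \<Rightarrow> 'v \<Rightarrow> nat" where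
  "gain N v = card (nbrs N v) - card (nbrs M v)"

text \<open>This is what remains at \<open>v\<close> once the values of the edges of
  \<open>M\<close> have cancelled: the empty slots that \<open>N\<close> fills, and the slots of
  \<open>M\<close> that \<open>N\<close> gives up for \<open>Bot\<close>. The \<open>+ 1\<close>
  accounts for the vote -1 of giving up a partner. When \<open>v\<close> gains, each filled slot
  yields -1, and a further \<open>- stretch\<close> if it lowers the deficiency. When
  \<open>v\<close> loses, giving up a partner of level at most \<open>T\<close> yields nothing
  positive, and other partners exist only if every loss raises the deficiency.\<close>

lemma Bot_contribution:
  assumes N: "matching G N" and v: "v \<in> verts G"
    and corr: "bij_betw f (padded G N v - padded G M v) (padded G M v - padded G N v)"
  shows "(\<Sum>i | Bot i \<in> padded G M v - padded G N v. slot_value v (Bot i))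
      - (\<Sum>i | Bot i \<in> padded G N v - padded G M v. slot_value v (f (Bot i)) + 1)
    \<le> stretch * (int (lquota G v - card (nbrs N v)) - int (lquota G v - card (nbrs M v))) - int (gain N v)"
proof -
  define m where "m = card (nbrs M v)"
  define n where "n = card (nbrs N v)"
  define U where "U = uquota G v"
  define L where "L = lquota G v"
  have mn: "m \<le> U" "n \<le> U" "L \<le> U"
    using N matching_M v lquota_le_uquota[OF v] by (auto simp: matching_def m_def n_def U_def L_def)
  have S0: "stretch \<ge> 0" using T_pos by (simp add: stretch_def)
  have P: "{i. Bot i \<in> padded G M v - padded G N v} = {U - n..<U - m}"
    by (auto simp: padded_def m_def n_def U_def)
  have Q: "{i. Bot i \<in> padded G N v - padded G M v} = {U - m..<U - n}"
    by (auto simp: padded_def m_def n_def U_def)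
  show ?thesis
  proof (cases "m \<le> n")
    case True
    then have Q0: "{U - m..<U - n} = {}" by auto
    have "(\<Sum>i\<in>{U - n..<U - m}. slot_value v (Bot i))
        = (\<Sum>i\<in>{U - n..<U - m}. - 1) - (\<Sum>i\<in>{U - n..<U - m}. if U - L \<le> i then stretch else 0)"
      by (subst sum_subtractf[symmetric]) (rule sum.cong, auto simp: slot_value_Bot U_def L_def)
    also have "(\<Sum>i\<in>{U - n..<U - m}. if U - L \<le> i then stretch else 0)
        = (\<Sum>i\<in>{i \<in> {U - n..<U - m}. U - L \<le> i}. stretch)"
      by (subst sum.inter_filter[symmetric]) auto
    \<comment> \<open>The deficiency slots have the numbers from \<open>U - L\<close> on. Those
      among the newly filled ones are exactly as many as the deficiency of \<open>v\<close> drops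
      by.\<close>
    also have "{i \<in> {U - n..<U - m}. U - L \<le> i} = {max (U - n) (U - L)..<U - m}"
      by auto
    also have "(\<Sum>i\<in>{max (U - n) (U - L)..<U - m}. stretch) = stretch * int (U - m - max (U - n) (U - L))"
      by simp
    also have "U - m - max (U - n) (U - L) = (L - m) - (L - n)"
      using True mn by auto
    also have "int (L - m - (L - n)) = int (L - m) - int (L - n)"
      using True by (intro of_nat_diff) auto
    finally have "(\<Sum>i\<in>{U - n..<U - m}. slot_value v (Bot i))
        = stretch * (int (L - n) - int (L - m)) - int (n - m)"
      using True mn by (simp add: algebra_simps)
    then show ?thesis
      unfolding P Q Q0 gain_def m_def[symmetric] n_def[symmetric] L_def[symmetric] by simp
  next
    case False
    then have P0: "{U - n..<U - m} = {}" by auto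
    \<comment> \<open>The copies of \<open>Bot\<close> form initial segments, and here the one for
      \<open>N\<close> is the longer; hence \<open>M\<close> has no copy of its own and every new
      copy displaces a partner.\<close>
    have fB: "\<exists>u\<in>nbrs M v. f (Bot i) = Nbr u" if i: "i \<in> {U - m..<U - n}" for i
    proof -
      have "Bot i \<in> padded G N v - padded G M v" using i Q by blast
      then have "f (Bot i) \<in> padded G M v - padded G N v"
        using corr by (auto simp: bij_betw_def)
      moreover have "f (Bot i) \<noteq> Bot k" for k
        using calculation P P0 by auto
      ultimately show ?thesis by (auto simp: padded_def)
    qed
    have "- (\<Sum>i\<in>{U - m..<U - n}. slot_value v (f (Bot i)) + 1) \<le> stretch * (int (L - n) - int (L - m))"
    proof (cases "\<exists>u\<in>nbrs M v. T < lv v u")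
      case True
      \<comment> \<open>A partner \<open>w\<close> above level \<open>T\<close> has fewer than
        \<open>L\<close> partners ahead of it. Partners of level at most \<open>T\<close> are all
        ahead of \<open>w\<close>, and the others obey the lower quota themselves, so every rank is
        below \<open>L\<close>.\<close>
      have "m \<le> L"
      proof -
        define r where "r u' u = better G v (lv v u') u' (lv v u) u" for u' u
        have fin: "finite (nbrs M v)" by (rule finite_nbrs_edges[OF M_edges])
        have lin: "strict_linear_on (nbrs M v) r"
          unfolding r_def using M_edges by (intro strict_linear_better[OF v]) (auto simp: nbrs_def)
        obtain w where w: "w \<in> nbrs M v" "T < lv v w" using True by blast
        have rank: "card {u' \<in> nbrs M v. r u' u} < capacity G T v (lv v u)" if "u \<in> nbrs M v" for u
          unfolding r_def by (rule within_capacity[OF v that])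
        have "card {u' \<in> nbrs M v. r u' u} < L" if u: "u \<in> nbrs M v" for u
        proof (cases "T < lv v u")
          case True
          then show ?thesis using rank[OF u] by (simp add: capacity_def L_def)
        next
          case False
          then have "r u w" using w by (simp add: r_def better_def)
          then show ?thesis
            using rank_less[OF fin lin u w(1)] rank[OF w(1)] w(2) by (simp add: capacity_def L_def)
        qed
        then show ?thesis
          unfolding m_def by (rule card_le_if_ranks_less[OF fin lin])
      qed
      have "- (\<Sum>i\<in>{U - m..<U - n}. slot_value v (f (Bot i)) + 1) \<le> (\<Sum>i\<in>{U - m..<U - n}. stretch)"
        unfolding sum_negf[symmetric]
      proof (rule sum_mono)
        fix i assume "i \<in> {U - m..<U - n}"
        then show "- (slot_value v (f (Bot i)) + 1) \<le> stretch"
          using fB[of i] lv_less by (force simp: slot_value_def stretch_def)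
      qed
      also have "\<dots> = stretch * int (m - n)"
        using mn False by simp
      also have "int (m - n) = int (L - n) - int (L - m)"
        using False \<open>m \<le> L\<close> by simp
      finally show ?thesis .
    next
      case noT: False
      have "- (\<Sum>i\<in>{U - m..<U - n}. slot_value v (f (Bot i)) + 1) \<le> 0"
        unfolding sum_negf[symmetric]
      proof (rule sum_nonpos)
        fix i assume "i \<in> {U - m..<U - n}"
        then obtain u where "u \<in> nbrs M v" "f (Bot i) = Nbr u" using fB by blast
        then show "- (slot_value v (f (Bot i)) + 1) \<le> 0"
          using noT by (force simp: slot_value_def)
      qed
      also have "0 \<le> stretch * (int (L - n) - int (L - m))"
        using S0 False by (intro mult_nonneg_nonneg) auto
      finally show ?thesis .
    qed
    then show ?thesis
      unfolding P Q P0 gain_def m_def[symmetric] n_def[symmetric] L_def[symmetric]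
      using False by simp
  qed
qed

lemma sum_padded_diff:
  fixes g :: "'v slot \<Rightarrow> int"
  assumes "F \<subseteq> edges G" "H \<subseteq> edges G" "v \<in> verts G"
  shows "(\<Sum>x\<in>padded G F v - padded G H v. g x)
    = (\<Sum>u\<in>nbrs (F - H) v. g (Nbr u)) + (\<Sum>i | Bot i \<in> padded G F v - padded G H v. g (Bot i))"
proof -
  let ?B = "{i. Bot i \<in> padded G F v - padded G H v}"
  have eq: "padded G F v - padded G H v = Nbr ` nbrs (F - H) v \<union> Bot ` ?B"
    using assms by (auto simp: padded_def nbrs_diff)
  have "?B \<subseteq> {..<uquota G v}" by (auto simp: padded_def)
  then have fin: "finite ?B" by (rule finite_subset) simp
  have "(\<Sum>x\<in>padded G F v - padded G H v. g x)
      = (\<Sum>x\<in>Nbr ` nbrs (F - H) v \<union> Bot ` ?B. g x)" by (simp only: eq[symmetric])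
  also have "\<dots> = sum g (Nbr ` nbrs (F - H) v) + sum g (Bot ` ?B)"
    using assms fin finite_nbrs_edges[of "F - H" v] by (intro sum.union_disjoint) auto
  also have "\<dots> = (\<Sum>u\<in>nbrs (F - H) v. g (Nbr u)) + (\<Sum>i\<in>?B. g (Bot i))"
    by (simp add: sum.reindex inj_on_def)
  finally show ?thesis .
qed

text \<open>As \<open>corr v\<close> is a bijection onto the slots that only \<open>M\<close> has,
  the total value of the displaced slots does not depend on the correspondence. Only the slots
  displaced by copies of \<open>Bot\<close> must be subtracted, and \<open>Bot_contribution\<close>
  bounds them whichever they are.\<close>

theorem Delta_bound:
  assumes N: "matching G N" and corr: "valid_corr G N M corr"
  shows "Delta G N M corr
    \<le> stretch * (int (deficiency G N) - int (deficiency G M)) - int (\<Sum>v\<in>verts G. gain N v)"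
proof -
  have NE: "N \<subseteq> edges G" using N by (simp add: matching_def)
  have ND: "N - M \<subseteq> edges G" and MD: "M - N \<subseteq> edges G" using NE M_edges by auto
  let ?P = "\<lambda>v. padded G N v - padded G M v"
  let ?Q = "\<lambda>v. padded G M v - padded G N v"
  have bij: "bij_betw (corr v) (?P v) (?Q v)" if "v \<in> verts G" for v
    using corr that by (simp add: valid_corr_def)
  have mem: "corr v (Nbr u) \<in> ?Q v" if "v \<in> verts G" "u \<in> nbrs (N - M) v" for v u
  proof -
    have "Nbr u \<in> ?P v" using that NE M_edges by (auto simp: padded_def nbrs_diff)
    then show ?thesis using bij[OF that(1)] by (auto simp: bij_betw_def)
  qed
  define B where "B v = {i. Bot i \<in> ?P v}" for v
  have vt: "vote G v N M (corr v) \<le> (\<Sum>u\<in>nbrs (N - M) v. edge_vote v u (corr v (Nbr u))) - int (card (B v))"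
    if v: "v \<in> verts G" for v
  proof -
    let ?f = "\<lambda>x. if slot_prefers G v x (corr v x) then 1
        else if slot_prefers G v (corr v x) x then -1 else (0::int)"
    have "vote G v N M (corr v) = (\<Sum>u\<in>nbrs (N - M) v. ?f (Nbr u)) + (\<Sum>i\<in>B v. ?f (Bot i))"
      unfolding vote_def B_def by (rule sum_padded_diff[OF NE M_edges v])
    also have "(\<Sum>u\<in>nbrs (N - M) v. ?f (Nbr u)) = (\<Sum>u\<in>nbrs (N - M) v. edge_vote v u (corr v (Nbr u)))"
    proof (rule sum.cong)
      fix u assume u: "u \<in> nbrs (N - M) v"
      have q: "corr v (Nbr u) \<in> ?Q v" using mem[OF v u] .
      show "?f (Nbr u) = edge_vote v u (corr v (Nbr u))"
      proof (cases "corr v (Nbr u)")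
        case (Nbr w)
        then have w: "w \<in> nbrs M v" using q by (auto simp: padded_def)
        have "u \<in> nbrs (edges G) v" "w \<in> nbrs (edges G) v" "u \<noteq> w"
          using u w NE M_edges v by (auto simp: nbrs_diff) (auto simp: nbrs_def)
        then have "prefers G v u w \<or> prefers G v w u" using prefers_total v by blast
        then show ?thesis using Nbr prefers_asym[OF v] by (auto simp: edge_vote_def)
      qed (simp add: edge_vote_def)
    qed simp
    also have "(\<Sum>i\<in>B v. ?f (Bot i)) = (\<Sum>i\<in>B v. -1)"
    proof (rule sum.cong)
      fix i assume "i \<in> B v"
      then have i: "Bot i \<in> ?P v" by (simp add: B_def)
      then have "corr v (Bot i) \<in> ?Q v" using bij[OF v] by (auto simp: bij_betw_def)
      \<comment> \<open>The copies of \<open>Bot\<close> in the two padded sets are nested initial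
        segments, so only one of the two differences can contain any.\<close>
      moreover have "corr v (Bot i) \<noteq> Bot k" for k
        using calculation i by (auto simp: padded_def image_iff)
      ultimately obtain u where "corr v (Bot i) = Nbr u"
        by (cases "corr v (Bot i)") auto
      then show "?f (Bot i) = -1" by simp
    qed simp
    finally show ?thesis by simp
  qed
  have edges_part: "(\<Sum>v\<in>verts G. \<Sum>u\<in>nbrs (N - M) v. edge_vote v u (corr v (Nbr u)))
      \<le> (\<Sum>v\<in>verts G. \<Sum>u\<in>nbrs (N - M) v. slot_value v (corr v (Nbr u)))"
    unfolding sum_nbrs[OF ND]
  proof (rule sum_mono, clarify)
    fix a b assume ab: "(a, b) \<in> N" "(a, b) \<notin> M"
    then have v: "a \<in> verts G" "b \<in> verts G" using NE edge_verts by blast+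
    have "corr a (Nbr b) \<in> padded G M a" "corr b (Nbr a) \<in> padded G M b"
      using mem[OF v(1), of b] mem[OF v(2), of a] ab by (auto simp: nbrs_def)
    then show "edge_vote a b (corr a (Nbr b)) + edge_vote b a (corr b (Nbr a))
        \<le> slot_value a (corr a (Nbr b)) + slot_value b (corr b (Nbr a))"
      using edge_vote_bound ab NE by auto
  qed
  have M_part: "(\<Sum>v\<in>verts G. \<Sum>u\<in>nbrs (M - N) v. slot_value v (Nbr u)) = 0"
    unfolding sum_nbrs[OF MD]
  proof (rule sum.neutral, clarify)
    fix a b assume "(a, b) \<in> M"
    then have "int (lv a b) + int (lv b a) + 1 = 2 * int T" using lv_sum[of a b] by linarith
    then show "slot_value a (Nbr b) + slot_value b (Nbr a) = 0"
      by (simp add: slot_value_def)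
  qed
  have slots: "(\<Sum>u\<in>nbrs (N - M) v. slot_value v (corr v (Nbr u)))
      = (\<Sum>u\<in>nbrs (M - N) v. slot_value v (Nbr u)) + (\<Sum>i | Bot i \<in> ?Q v. slot_value v (Bot i))
        - (\<Sum>i\<in>B v. slot_value v (corr v (Bot i)))" if v: "v \<in> verts G" for v
  proof -
    have "(\<Sum>x\<in>?P v. slot_value v (corr v x)) = (\<Sum>y\<in>?Q v. slot_value v y)"
      using sum.reindex_bij_betw[OF bij[OF v]] .
    then show ?thesis
      unfolding sum_padded_diff[OF NE M_edges v] sum_padded_diff[OF M_edges NE v] B_def by linarith
  qed
  have fB: "finite (B v)" for v
    by (rule finite_subset[of _ "{..<uquota G v}"]) (auto simp: B_def padded_def)
  have "Delta G N M corr \<le> (\<Sum>v\<in>verts G. (\<Sum>u\<in>nbrs (N - M) v. edge_vote v u (corr v (Nbr u))) - int (card (B v)))"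
    unfolding Delta_def by (rule sum_mono) (rule vt)
  also have "\<dots> \<le> (\<Sum>v\<in>verts G. (\<Sum>u\<in>nbrs (N - M) v. slot_value v (corr v (Nbr u))) - int (card (B v)))"
    using edges_part by (simp add: sum_subtractf)
  also have "\<dots> = (\<Sum>v\<in>verts G. (\<Sum>u\<in>nbrs (M - N) v. slot_value v (Nbr u))
      + ((\<Sum>i | Bot i \<in> ?Q v. slot_value v (Bot i)) - (\<Sum>i\<in>B v. slot_value v (corr v (Bot i)) + 1)))"
    by (rule sum.cong) (auto simp: slots sum.distrib)
  also have "\<dots> = (\<Sum>v\<in>verts G. (\<Sum>i | Bot i \<in> ?Q v. slot_value v (Bot i))
      - (\<Sum>i\<in>B v. slot_value v (corr v (Bot i)) + 1))"
    by (subst sum.distrib) (simp only: M_part add_0)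
  also have "\<dots> \<le> (\<Sum>v\<in>verts G. stretch * (int (lquota G v - card (nbrs N v))
      - int (lquota G v - card (nbrs M v))) - int (gain N v))"
    unfolding B_def by (intro sum_mono Bot_contribution N bij)
  also have "\<dots> = stretch * (int (deficiency G N) - int (deficiency G M)) - int (\<Sum>v\<in>verts G. gain N v)"
    by (simp only: deficiency_def sum_subtractf sum_distrib_left[symmetric] of_nat_sum)
  finally show ?thesis .
qed

section \<open>Criticality, popularity and maximal size for large \<open>T\<close>\<close>

context
  assumes T_large: "2 * card (edges G) + 1 < T"
begin

text \<open>The assumption on \<open>T\<close> says precisely that \<open>stretch\<close> exceeds
  \<open>4 * card (edges G)\<close>. Saving a single unit of deficiency would thus push
  \<open>Delta\<close> below what the number of edges allows.\<close>

theorem critical_M: "critical G M"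
  unfolding critical_def
proof (intro conjI notI matching_M, clarify)
  fix N assume N: "matching G N" and d: "deficiency G N < deficiency G M"
  obtain corr where corr: "valid_corr G N M corr"
    using valid_corr_exists[OF matching_M N] by blast
  have "stretch * (int (deficiency G N) - int (deficiency G M)) \<le> stretch * (-1)"
    using d T_large by (intro mult_left_mono) (auto simp: stretch_def)
  moreover have "int (4 * card (edges G)) < stretch"
    using T_large by (simp add: stretch_def)
  moreover have "0 \<le> int (\<Sum>v\<in>verts G. gain N v)" by (rule of_nat_0_le_iff)
  ultimately show False
    using Delta_bound[OF N corr] Delta_lower_bound[OF matching_M N, of corr] by linarith
qed

lemma Delta_critical:
  assumes N: "critical G N" and corr: "valid_corr G N M corr"
  shows "Delta G N M corr \<le> - int (\<Sum>v\<in>verts G. gain N v)"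
proof -
  have "deficiency G N = deficiency G M" "matching G N"
    using N critical_M matching_M unfolding critical_def by (meson linorder_neqE_nat)+
  then show ?thesis using Delta_bound[OF _ corr] by simp
qed

theorem popular_critical_M: "popular_critical G M"
  using critical_M Delta_critical unfolding popular_in_def
  by (fastforce simp: not_less intro: order.trans)

text \<open>A larger \<open>N\<close> has a larger degree sum, hence a positive gain, and loses to
  \<open>M\<close> under every correspondence. Read backwards, the critical matching
  \<open>M\<close> beats \<open>N\<close>, so \<open>N\<close> was not popular.\<close>

theorem card_popular_critical_le:
  assumes N: "popular_critical G N"
  shows "card N \<le> card M"
proof (rule ccontr)
  assume less: "\<not> card N \<le> card M"
  have cN: "critical G N" using N by (simp add: popular_in_def)
  then have mN: "matching G N" by (simp add: critical_def)
  then have NE: "N \<subseteq> edges G" by (simp add: matching_def)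
  have "(\<Sum>v\<in>verts G. card (nbrs M v)) < (\<Sum>v\<in>verts G. card (nbrs N v))"
    using less by (simp add: sum_card_nbrs NE M_edges)
  moreover have "(\<Sum>v\<in>verts G. card (nbrs N v)) \<le> (\<Sum>v\<in>verts G. card (nbrs M v) + gain N v)"
    by (rule sum_mono) (simp add: gain_def)
  ultimately have pos: "0 < (\<Sum>v\<in>verts G. gain N v)" by (simp add: sum.distrib)
  obtain corr where corr: "valid_corr G N M corr"
    using valid_corr_exists[OF matching_M mN] by blast
  then have "Delta G N M corr < 0" using Delta_critical[OF cN corr] pos by linarith
  then show False
    using Delta_inverse[OF corr] critical_M N unfolding popular_in_def by force
qed

end

end

section \<open>Deferred acceptance\<close>

text \<open>\<open>r\<close> gives each edge its current level on the scale of its end in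
  \<open>sideA\<close>. That end proposes along its best edges, as many as the capacity at their
  level permits; level \<open>2 * T\<close> marks an edge as given up.\<close>

definition offered :: "'v quota_graph \<Rightarrow> nat \<Rightarrow> ('v \<times> 'v \<Rightarrow> nat) \<Rightarrow> ('v \<times> 'v) set" where
  "offered G T r = {(a, b) \<in> edges G. r (a, b) < 2 * T \<and>
     card {b'. (a, b') \<in> edges G \<and> better G a (r (a, b')) b' (r (a, b)) b} < capacity G T a (r (a, b))}"

text \<open>The level \<open>l\<close> is a parameter and need not be \<open>r (a, b)\<close>: the
  same set describes the competition for the present offer and for the offers of \<open>a\<close> at
  levels already passed.\<close>

definition offers_above :: "'v quota_graph \<Rightarrow> nat \<Rightarrow> ('v \<times> 'v \<Rightarrow> nat) \<Rightarrow> 'v \<Rightarrow> nat \<Rightarrow> 'v \<Rightarrow> 'v set" where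
  "offers_above G T r b l a =
     {a'. (a', b) \<in> offered G T r \<and> better G b (2 * T - 1 - r (a', b)) a' (2 * T - 1 - l) a}"

definition rejected :: "'v quota_graph \<Rightarrow> nat \<Rightarrow> ('v \<times> 'v \<Rightarrow> nat) \<Rightarrow> ('v \<times> 'v) set" where
  "rejected G T r = {(a, b) \<in> offered G T r.
     capacity G T b (2 * T - 1 - r (a, b)) \<le> card (offers_above G T r b (r (a, b)) a)}"

text \<open>The invariant of deferred acceptance: \<open>b\<close> would still refuse the edge at
  every level it has passed.\<close>

definition admissible :: "'v quota_graph \<Rightarrow> nat \<Rightarrow> ('v \<times> 'v \<Rightarrow> nat) \<Rightarrow> bool" where
  "admissible G T r \<longleftrightarrow> (\<forall>(a, b)\<in>edges G. r (a, b) \<le> 2 * T \<and>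
     (\<forall>l < r (a, b). capacity G T b (2 * T - 1 - l) \<le> card (offers_above G T r b l a)))"

section \<open>The invariant of deferred acceptance and the stability of its outcome\<close>

context quota_instance
begin

lemma offered_edges: "offered G T r \<subseteq> edges G"
  by (auto simp: offered_def)

lemma rejected_offered: "rejected G T r \<subseteq> offered G T r"
  by (auto simp: rejected_def)

lemma finite_partners: "finite {b. (a, b) \<in> edges G \<and> P b}" "finite {a. (a, b) \<in> edges G \<and> Q a}"
  by (rule finite_subset[of _ "snd ` edges G"], force, simp add: finite_edges)
    (rule finite_subset[of _ "fst ` edges G"], force, simp add: finite_edges)

lemma finite_offers_above: "finite (offers_above G T r b l a)"
  by (rule finite_subset[OF _ finite_partners(2)[of b "\<lambda>_. True"]])
    (use offered_edges in \<open>auto simp: offers_above_def\<close>)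

text \<open>Raising \<open>e\<close> makes it less attractive to its end in \<open>sideA\<close>, so
  no other edge meets more competition than before. Only \<open>e\<close> itself may cease to be
  offered.\<close>

lemma offered_raise:
  assumes "(a, b) \<in> offered G T r" "(a, b) \<noteq> e"
  shows "(a, b) \<in> offered G T (r(e := Suc (r e)))"
proof -
  let ?r = "r(e := Suc (r e))"
  have "{b'. (a, b') \<in> edges G \<and> better G a (?r (a, b')) b' (?r (a, b)) b}
      \<subseteq> {b'. (a, b') \<in> edges G \<and> better G a (r (a, b')) b' (r (a, b)) b}"
    using assms(2) by (auto simp: better_def)
  then have "card {b'. (a, b') \<in> edges G \<and> better G a (?r (a, b')) b' (?r (a, b)) b}
      \<le> card {b'. (a, b') \<in> edges G \<and> better G a (r (a, b')) b' (r (a, b)) b}"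
    by (intro card_mono finite_partners)
  then show ?thesis using assms by (auto simp: offered_def)
qed

text \<open>Only the offer \<open>e\<close> can vanish. The level newly passed is covered by the
  rejection, whose witnesses do not include \<open>ea\<close>. If \<open>ea\<close> was a witness
  for an earlier refusal of some \<open>(a, eb)\<close>, the witnesses against \<open>e\<close>
  replace it: they beat \<open>e\<close>, hence also what \<open>e\<close> beats, and they fill the
  capacity at a level at least as good, which is no smaller.\<close>

lemma admissible_raise:
  assumes adm: "admissible G T r" and e: "e \<in> rejected G T r"
  shows "admissible G T (r(e := Suc (r e)))"
proof -
  let ?r = "r(e := Suc (r e))"
  obtain ea eb where e_eq: "e = (ea, eb)" by (cases e)
  have eo: "(ea, eb) \<in> offered G T r" using e rejected_offered e_eq by blast
  have ev: "eb \<in> verts G" using eo offered_edges edge_verts by blast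
  have cap_e: "capacity G T eb (2 * T - 1 - r e) \<le> card (offers_above G T r eb (r e) ea)"
    using e by (auto simp: rejected_def e_eq)
  have keep: "{a' \<in> offers_above G T r b l a. (a', b) \<noteq> e} \<subseteq> offers_above G T ?r b l a" for b l a
    using offered_raise[of _ b T r e] by (auto simp: offers_above_def)
  have self: "ea \<notin> offers_above G T r eb (r e) ea"
    using prefers_irrefl[OF ev] by (auto simp: offers_above_def better_def e_eq)
  have "capacity G T b (2 * T - 1 - l) \<le> card (offers_above G T ?r b l a)"
    if ab: "(a, b) \<in> edges G" and l: "l < ?r (a, b)" for a b l
  proof -
    have "\<exists>X. X \<subseteq> offers_above G T ?r b l a \<and> capacity G T b (2 * T - 1 - l) \<le> card X"
    proof (cases "(a, b) = e \<and> l = r e")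
      case True
      have "offers_above G T r eb (r e) ea \<subseteq> offers_above G T ?r eb (r e) ea"
        using keep[of eb "r e" ea] self by (auto simp: e_eq)
      then show ?thesis using True cap_e e_eq by auto
    next
      case False
      then have "l < r (a, b)" using l by (auto split: if_splits)
      then have adm_l: "capacity G T b (2 * T - 1 - l) \<le> card (offers_above G T r b l a)"
        using adm ab by (auto simp: admissible_def)
      show ?thesis
      proof (cases "b = eb \<and> ea \<in> offers_above G T r b l a")
        case True
        then have be: "better G eb (2 * T - 1 - r e) ea (2 * T - 1 - l) a"
          by (auto simp: offers_above_def e_eq)
        have "offers_above G T r eb (r e) ea \<subseteq> offers_above G T r eb l a"
          using better_trans[OF ev _ be] by (auto simp: offers_above_def)
        then have "offers_above G T r eb (r e) ea \<subseteq> offers_above G T ?r b l a"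
          using keep[of eb l a] self True e_eq by auto
        moreover have "capacity G T b (2 * T - 1 - l) \<le> capacity G T eb (2 * T - 1 - r e)"
          using be ev True capacity_antimono[of eb "2 * T - 1 - r e" "2 * T - 1 - l"]
          by (auto simp: better_def)
        ultimately show ?thesis using cap_e order.trans by blast
      next
        case False
        then have "offers_above G T r b l a \<subseteq> offers_above G T ?r b l a"
          using keep[of b l a] e_eq by auto
        then show ?thesis using adm_l by blast
      qed
    qed
    then show ?thesis using card_mono[OF finite_offers_above] order.trans by metis
  qed
  moreover have "?r (a, b) \<le> 2 * T" if "(a, b) \<in> edges G" for a b
    using adm that eo by (auto simp: admissible_def offered_def e_eq)
  ultimately show ?thesis
    by (auto simp: admissible_def simp del: fun_upd_apply)
qed

lemma admissible_zero: "admissible G T (\<lambda>_. 0)"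
  by (auto simp: admissible_def)

lemma sum_raise:
  assumes "e \<in> edges G"
  shows "(\<Sum>x\<in>edges G. (r(e := Suc (r e))) x) = Suc (\<Sum>x\<in>edges G. r x)"
proof -
  have "(\<Sum>x\<in>edges G. (r(e := Suc (r e))) x) = Suc (r e) + (\<Sum>x\<in>edges G - {e}. r x)"
    using assms by (simp add: sum.remove[OF finite_edges])
  also have "\<dots> = Suc (\<Sum>x\<in>edges G. r x)"
    using assms by (simp add: sum.remove[OF finite_edges])
  finally show ?thesis .
qed

lemma sum_admissible_le: "admissible G T r \<Longrightarrow> (\<Sum>x\<in>edges G. r x) \<le> 2 * T * card (edges G)"
  using sum_bounded_above[of "edges G" r "2 * T"] by (auto simp: admissible_def mult.commute)

text \<open>An admissible \<open>r\<close> of maximal level sum exists because the sums are bounded;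
  a rejection would allow a further raise. This yields existence for arbitrary vertex types,
  independently of the machine.\<close>

lemma admissible_without_rejection_exists: "\<exists>r. admissible G T r \<and> rejected G T r = {}"
proof -
  have "\<exists>r. admissible G T r \<and> (\<forall>r'. admissible G T r' \<longrightarrow> (\<Sum>x\<in>edges G. r' x) \<le> (\<Sum>x\<in>edges G. r x))"
    using admissible_zero sum_admissible_le
    by (intro ex_has_greatest_nat[where b = "Suc (2 * T * card (edges G))"]) (auto simp: less_Suc_eq_le)
  then obtain r where r: "admissible G T r"
    "\<And>r'. admissible G T r' \<Longrightarrow> (\<Sum>x\<in>edges G. r' x) \<le> (\<Sum>x\<in>edges G. r x)" by blast
  have "rejected G T r = {}"
  proof (rule equals0I)
    fix e assume e: "e \<in> rejected G T r"
    then have "e \<in> edges G" using rejected_offered offered_edges by blast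
    then show False using r(2)[OF admissible_raise[OF r(1) e]] sum_raise[of e r] by simp
  qed
  then show ?thesis using r(1) by blast
qed

text \<open>Capacities hold on \<open>sideA\<close> by the definition of an offer and on
  \<open>sideB\<close> since nothing is rejected. For a missing edge, a level below
  \<open>r (a, b)\<close> is refused by \<open>b\<close> by admissibility; at any other level
  \<open>a\<close> is served, since its edge fails to be offered already at the better level
  \<open>r (a, b)\<close>.\<close>

lemma offered_levelled_matching:
  assumes T: "0 < T" and adm: "admissible G T r" and no_rej: "rejected G T r = {}"
  shows "levelled_matching G T (offered G T r)
    (\<lambda>v u. if v \<in> sideA G then r (v, u) else 2 * T - 1 - r (u, v))"
proof -
  let ?M = "offered G T r"
  let ?lv = "\<lambda>v u. if v \<in> sideA G then r (v, u) else 2 * T - 1 - r (u, v)"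
  note ME = offered_edges[of T r]
  have B: "b \<notin> sideA G" if "b \<in> sideB G" for b using sides_disjoint that by blast
  have cap: "card {u' \<in> nbrs ?M v. better G v (?lv v u') u' (?lv v u) u} < capacity G T v (?lv v u)"
    if v: "v \<in> verts G" and u: "u \<in> nbrs ?M v" for v u
  proof (cases "v \<in> sideA G")
    case True
    then have uM: "(v, u) \<in> ?M" using u nbrs_sideA[OF ME] by blast
    have "{u' \<in> nbrs ?M v. better G v (r (v, u')) u' (r (v, u)) u}
        \<subseteq> {b'. (v, b') \<in> edges G \<and> better G v (r (v, b')) b' (r (v, u)) u}"
      using True ME by (auto simp: nbrs_sideA[OF ME])
    then have "card {u' \<in> nbrs ?M v. better G v (r (v, u')) u' (r (v, u)) u}
        \<le> card {b'. (v, b') \<in> edges G \<and> better G v (r (v, b')) b' (r (v, u)) u}"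
      by (intro card_mono finite_partners)
    then show ?thesis using uM True by (simp add: offered_def)
  next
    case False
    then have vB: "v \<in> sideB G" using v by (simp add: verts_def)
    then have uM: "(u, v) \<in> ?M" using u nbrs_sideB[OF ME] by blast
    have "{u' \<in> nbrs ?M v. better G v (?lv v u') u' (?lv v u) u} = offers_above G T r v (r (u, v)) u"
      using False vB by (auto simp: nbrs_sideB[OF ME] offers_above_def)
    moreover have "(u, v) \<notin> rejected G T r" using no_rej by simp
    ultimately show ?thesis using uM False by (simp add: rejected_def not_le)
  qed
  show ?thesis
  proof unfold_locales
    show "0 < T" by (rule T)
    show "matching G ?M"
      unfolding matching_def
    proof (intro conjI ballI ME)
      fix v assume v: "v \<in> verts G"
      have sub: "nbrs ?M v \<subseteq> nbrs (edges G) v" using ME by (auto simp: nbrs_def)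
      show "card (nbrs ?M v) \<le> uquota G v"
      proof (rule card_le_if_ranks_less[OF finite_nbrs_edges[OF ME] strict_linear_better[OF v sub]])
        fix u assume "u \<in> nbrs ?M v"
        moreover have "capacity G T v l \<le> uquota G v" for l
          using lquota_le_uquota[OF v] by (simp add: capacity_def)
        ultimately show "card {z \<in> nbrs ?M v. better G v (?lv v z) z (?lv v u) u} < uquota G v"
          using cap[OF v, of u] order.strict_trans2 by blast
      qed
    qed
    show "?lv a b + ?lv b a + 1 = 2 * T" if "(a, b) \<in> ?M" for a b
    proof -
      have "(a, b) \<in> edges G" "r (a, b) < 2 * T" using that by (auto simp: offered_def)
      then show ?thesis using edge_sides[of a b] B[of b] by auto
    qed
    show "card {u' \<in> nbrs ?M v. better G v (?lv v u') u' (?lv v u) u} < capacity G T v (?lv v u)"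
      if "v \<in> verts G" "u \<in> nbrs ?M v" for v u
      by (rule cap[OF that])
    show "capacity G T a l \<le> card {u' \<in> nbrs ?M a. better G a (?lv a u') u' l b} \<or>
        capacity G T b (2 * T - 1 - l)
          \<le> card {u' \<in> nbrs ?M b. better G b (?lv b u') u' (2 * T - 1 - l) a}"
      if e: "(a, b) \<in> edges G - ?M" and l: "l < 2 * T" for a b l
    proof (cases "l < r (a, b)")
      case True
      then have "capacity G T b (2 * T - 1 - l) \<le> card (offers_above G T r b l a)"
        using adm e by (auto simp: admissible_def)
      moreover have "offers_above G T r b l a
          = {u' \<in> nbrs ?M b. better G b (?lv b u') u' (2 * T - 1 - l) a}"
        using edge_sides[of a b] B[of b] e by (auto simp: offers_above_def nbrs_sideB[OF ME])
      ultimately show ?thesis by simp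
    next
      case False
      have a: "a \<in> verts G" "a \<in> sideA G" using e edge_verts edge_sides by auto
      define S where "S = {x. (a, x) \<in> edges G \<and> better G a (r (a, x)) x (r (a, b)) b}"
      define k where "k = capacity G T a (r (a, b))"
      define X where "X = {x \<in> S. card {z \<in> S. better G a (r (a, z)) z (r (a, x)) x} < k}"
      \<comment> \<open>Here \<open>r (a, b) \<le> l < 2 * T\<close>, so the edge is not given up
        and can be missing only because too many edges are ahead of it.\<close>
      have "k \<le> card S"
        using e False l by (auto simp: offered_def S_def k_def not_less)
      moreover have lin: "strict_linear_on S (\<lambda>z x. better G a (r (a, z)) z (r (a, x)) x)"
        by (rule strict_linear_better[OF a(1)]) (auto simp: S_def nbrs_def)
      ultimately have "card X = k"
        unfolding X_def by (intro card_ranks_less) (auto simp: S_def intro: finite_partners)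
      \<comment> \<open>The edges ahead of \<open>(a, b)\<close> need not all be offered, but the
        \<open>k\<close> best of them are: fewer than \<open>k\<close> edges precede each, and the
        capacity at its level is at least \<open>k\<close>.\<close>
      moreover have "X \<subseteq> {u' \<in> nbrs ?M a. better G a (?lv a u') u' l b}"
      proof
        fix x assume x: "x \<in> X"
        then have xS: "(a, x) \<in> edges G" "better G a (r (a, x)) x (r (a, b)) b"
          by (auto simp: X_def S_def)
        have "{z. (a, z) \<in> edges G \<and> better G a (r (a, z)) z (r (a, x)) x}
            = {z \<in> S. better G a (r (a, z)) z (r (a, x)) x}"
          using better_trans[OF a(1) _ xS(2)] by (auto simp: S_def)
        moreover have "r (a, x) \<le> r (a, b)" using xS(2) by (auto simp: better_def)
        moreover from this have "k \<le> capacity G T a (r (a, x))"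
          unfolding k_def by (rule capacity_antimono[OF a(1)])
        ultimately have "(a, x) \<in> ?M"
          using x xS False l by (auto simp: X_def offered_def)
        moreover have "better G a (r (a, x)) x l b"
          using xS(2) False by (auto simp: better_def)
        ultimately show "x \<in> {u' \<in> nbrs ?M a. better G a (?lv a u') u' l b}"
          using a by (simp add: nbrs_sideA[OF ME])
      qed
      ultimately have "k \<le> card {u' \<in> nbrs ?M a. better G a (?lv a u') u' l b}"
        using card_mono[of "{u' \<in> nbrs ?M a. better G a (?lv a u') u' l b}" X]
        by (simp add: finite_nbrs_edges[OF ME])
      moreover have "capacity G T a l \<le> k"
        unfolding k_def using False by (intro capacity_antimono[OF a(1)]) simp
      ultimately show ?thesis by linarith
    qed
  qed
qed

theorem offered_solution:
  assumes "2 * card (edges G) + 1 < T" "admissible G T r" "rejected G T r = {}"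
  shows "matching G (offered G T r)" "critical G (offered G T r)" "popular_critical G (offered G T r)"
    "popular_critical G N \<Longrightarrow> card N \<le> card (offered G T r)"
proof -
  interpret levelled_matching G T "offered G T r"
    "\<lambda>v u. if v \<in> sideA G then r (v, u) else 2 * T - 1 - r (u, v)"
    using assms by (intro offered_levelled_matching) auto
  show "matching G (offered G T r)" by (rule matching_M)
  show "critical G (offered G T r)" by (rule critical_M[OF assms(1)])
  show "popular_critical G (offered G T r)" by (rule popular_critical_M[OF assms(1)])
  show "popular_critical G N \<Longrightarrow> card N \<le> card (offered G T r)"
    by (rule card_popular_critical_le[OF assms(1)])
qed

theorem popular_critical_exists: "\<exists>M. popular_critical G M"
proof -
  obtain r where "admissible G (2 * card (edges G) + 2) r" "rejected G (2 * card (edges G) + 2) r = {}"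
    using admissible_without_rejection_exists by blast
  then show ?thesis using offered_solution(3)[of "2 * card (edges G) + 2" r] by auto
qed

end

section \<open>Bounded loops\<close>

text \<open>Total correctness with the number of steps as a further result. One terminating run is
  all that \<open>solves_in_polynomial_time\<close> asks for.\<close>

definition wp :: "com \<Rightarrow> (nat \<Rightarrow> state \<Rightarrow> bool) \<Rightarrow> state \<Rightarrow> bool" where
  "wp c Q s \<longleftrightarrow> (\<exists>t s'. exec c s t s' \<and> Q t s')"

lemma wp_Skip [simp]: "wp Skip Q s \<longleftrightarrow> Q 1 s"
  using exec.Skip by (auto simp: wp_def elim: exec_SkipE)

lemma wp_Assign [simp]: "wp (Assign r d e) Q s \<longleftrightarrow> Q 1 (update s r (aval d s) (aval e s))"
  using exec.Assign by (fastforce simp: wp_def elim: exec_AssignE)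

lemma wp_Seq [simp]: "wp (Seq c1 c2) Q s \<longleftrightarrow> wp c1 (\<lambda>t. wp c2 (\<lambda>t'. Q (t + t'))) s"
  by (fastforce simp: wp_def intro: exec.Seq elim: exec_SeqE)

lemma wp_If [simp]:
  "wp (If b c1 c2) Q s \<longleftrightarrow> (if bval b s then wp c1 (\<lambda>t. Q (t + 1)) s else wp c2 (\<lambda>t. Q (t + 1)) s)"
proof (cases "bval b s")
  case True
  then have "exec (If b c1 c2) s t s' \<longleftrightarrow> (\<exists>u. t = u + 1 \<and> exec c1 s u s')" for t s'
    using exec.IfTrue[of b s c1 _ s' c2] by (auto elim: exec_IfE)
  then show ?thesis using True by (auto simp: wp_def)
next
  case False
  then have "exec (If b c1 c2) s t s' \<longleftrightarrow> (\<exists>u. t = u + 1 \<and> exec c2 s u s')" for t s'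
    using exec.IfFalse[of b s c2 _ s' c1] by (auto elim: exec_IfE)
  then show ?thesis using False by (auto simp: wp_def)
qed

lemma wp_mono: "wp c Q s \<Longrightarrow> (\<And>t s'. Q t s' \<Longrightarrow> Q' t s') \<Longrightarrow> wp c Q' s"
  by (auto simp: wp_def)

lemma wp_time_mono:
  assumes "wp c (\<lambda>t s'. t \<le> a \<and> P s') s" "a \<le> b" "\<And>s'. P s' \<Longrightarrow> Q s'"
  shows "wp c (\<lambda>t s'. t \<le> b \<and> Q s') s"
  using assms(2,3) by (auto intro!: wp_mono[OF assms(1)])

lemma wp_SeqI:
  assumes "wp c1 (\<lambda>t s'. t \<le> t1 \<and> P s') s"
    and "\<And>s'. P s' \<Longrightarrow> wp c2 (\<lambda>t s''. t \<le> t2 \<and> Q s'') s'"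
  shows "wp (Seq c1 c2) (\<lambda>t s''. t \<le> t1 + t2 \<and> Q s'') s"
  unfolding wp_Seq
  by (rule wp_mono[OF assms(1)]) (auto intro: wp_mono[OF assms(2)])

abbreviation var :: "nat \<Rightarrow> aexp" where
  "var r \<equiv> Cell r (Const 0)"

abbreviation assign :: "nat \<Rightarrow> aexp \<Rightarrow> com" where
  "assign r e \<equiv> Assign r (Const 0) e"

abbreviation incr :: "nat \<Rightarrow> nat \<Rightarrow> com" where
  "incr r n \<equiv> assign r (Plus (var r) (Const n))"

definition For :: "nat \<Rightarrow> aexp \<Rightarrow> com \<Rightarrow> com" where
  "For i b c = Seq (assign i (Const 0)) (While (Less (var i) b) (Seq c (incr i 1)))"

text \<open>A pass costs the body, the increment and the test; the final 2 pays for the initial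
  assignment and the last test. The bound is evaluated before every pass, so the invariant has to
  fix its value. The induction runs over the number of passes still to come.\<close>

lemma wp_For:
  assumes init: "I 0 (update s i 0 0)"
    and bound: "\<And>k s. k \<le> n \<Longrightarrow> I k s \<Longrightarrow> s i 0 = k \<Longrightarrow> aval b s = n"
    and body: "\<And>k s. k < n \<Longrightarrow> I k s \<Longrightarrow> s i 0 = k \<Longrightarrow>
      wp c (\<lambda>u s'. u \<le> t \<and> s' i 0 = k \<and> I (Suc k) (update s' i 0 (Suc k))) s"
  shows "wp (For i b c) (\<lambda>u s'. u \<le> n * (t + 2) + 2 \<and> I n s' \<and> s' i 0 = n) s"
proof -
  let ?w = "While (Less (var i) b) (Seq c (incr i 1))"
  have loop: "wp ?w (\<lambda>u s'. u \<le> d * (t + 2) + 1 \<and> I n s' \<and> s' i 0 = n) s"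
    if "d \<le> n" "I (n - d) s" "s i 0 = n - d" for d s
    using that
  proof (induction d arbitrary: s)
    case 0
    then have "\<not> bval (Less (var i) b) s" using bound[of n s] by simp
    then have "exec ?w s 1 s" by (rule exec.WhileFalse)
    then show ?case using 0 by (auto simp: wp_def)
  next
    case (Suc d)
    then have k: "n - Suc d < n" "Suc (n - Suc d) = n - d" by auto
    have b: "bval (Less (var i) b) s"
      using Suc.prems bound[of "n - Suc d" s] k by simp
    obtain u s' where c: "exec c s u s'" "u \<le> t" "s' i 0 = n - Suc d"
      "I (n - d) (update s' i 0 (n - d))"
      using body[OF k(1) Suc.prems(2,3)] by (auto simp: wp_def k)
    have "exec (incr i 1) s' 1 (update s' i 0 (n - d))"
      using exec.Assign[of i "Const 0" "Plus (var i) (Const 1)" s'] c(3) k by simp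
    then have step: "exec (Seq c (incr i 1)) s (u + 1) (update s' i 0 (n - d))"
      by (rule exec.Seq[OF c(1)])
    have "wp ?w (\<lambda>u s'. u \<le> d * (t + 2) + 1 \<and> I n s' \<and> s' i 0 = n) (update s' i 0 (n - d))"
      using Suc.prems(1) by (intro Suc.IH c(4)) (simp_all add: update_def)
    then obtain u' s'' where w: "exec ?w (update s' i 0 (n - d)) u' s''"
      "u' \<le> d * (t + 2) + 1" "I n s''" "s'' i 0 = n"
      by (auto simp: wp_def)
    have "exec ?w s (u + 1 + u' + 1) s''" by (rule exec.WhileTrue[OF b step w(1)])
    then show ?case using w c(2) by (auto simp: wp_def intro!: exI)
  qed
  show ?thesis
    unfolding For_def using loop[of n "update s i 0 0"] init
    by (auto simp: update_def elim: wp_mono)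
qed

definition Count :: "nat \<Rightarrow> nat \<Rightarrow> aexp \<Rightarrow> bexp \<Rightarrow> com" where
  "Count i x b cond = Seq (assign x (Const 0)) (For i b (If cond (incr x 1) Skip))"

text \<open>\<open>indep\<close> says that bound and condition see the changing registers only
  through the counter \<open>i\<close>, so the values of the start state may be used
  throughout.\<close>

lemma wp_Count:
  assumes ix: "i \<noteq> x"
    and indep: "\<And>s'. \<forall>r. r \<notin> {i, x} \<longrightarrow> s' r = s r \<Longrightarrow>
      aval b s' = n \<and> (s' i 0 < n \<longrightarrow> bval cond s' = P (s' i 0))"
  shows "wp (Count i x b cond) (\<lambda>t s'. t \<le> n * 4 + 3 \<and> s' x 0 = card {k. k < n \<and> P k} \<and>
    (\<forall>r. r \<notin> {i, x} \<longrightarrow> s' r = s r)) s"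
proof -
  define I where "I k s' \<longleftrightarrow> s' x 0 = card {j. j < k \<and> P j} \<and> (\<forall>r. r \<notin> {i, x} \<longrightarrow> s' r = s r)"
    for k s'
  have card_Suc: "card {j. j < Suc k \<and> P j} = card {j. j < k \<and> P j} + (if P k then 1 else 0)" for k
  proof -
    have "{j. j < Suc k \<and> P j} = (if P k then insert k {j. j < k \<and> P j} else {j. j < k \<and> P j})"
      by (auto simp: less_Suc_eq)
    then show ?thesis by simp
  qed
  have "wp (For i b (If cond (incr x 1) Skip)) (\<lambda>t s'. t \<le> n * (2 + 2) + 2 \<and> I n s' \<and> s' i 0 = n)
      (update s x 0 0)"
  proof (rule wp_For)
    show "I 0 (update (update s x 0 0) i 0 0)"
      using ix by (auto simp: I_def update_def)
    show "aval b s' = n" if "I k s'" for k s'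
      using that indep by (auto simp: I_def)
    show "wp (If cond (incr x 1) Skip)
        (\<lambda>u s'. u \<le> 2 \<and> s' i 0 = k \<and> I (Suc k) (update s' i 0 (Suc k))) s'"
      if "k < n" "I k s'" "s' i 0 = k" for k s'
    proof -
      have "bval cond s' = P k" using that indep[of s'] by (auto simp: I_def)
      then show ?thesis using that ix by (auto simp: I_def update_def card_Suc)
    qed
  qed
  then show ?thesis
    unfolding Count_def by (auto simp: I_def elim: wp_mono)
qed

section \<open>Reading the instance\<close>

abbreviation Eq :: "aexp \<Rightarrow> aexp \<Rightarrow> bexp" where
  "Eq d e \<equiv> And (Not (Less d e)) (Not (Less e d))"

abbreviation Or :: "bexp \<Rightarrow> bexp \<Rightarrow> bexp" where
  "Or b c \<equiv> Not (And (Not b) (Not c))"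

abbreviation entry :: "nat \<Rightarrow> nat \<Rightarrow> aexp" where
  "entry r i \<equiv> Cell r (var i)"

text \<open>Registers \<open>RA\<close>, \<open>RB\<close>, \<open>RrankA\<close>, \<open>RrankB\<close>, \<open>Rlev\<close> and \<open>Roff\<close> are indexed by the edges, numbered in
  the order in which they are read; \<open>Rlq\<close> and \<open>Ruq\<close> are indexed by the names of the vertices.\<close>

abbreviation (input) Rpos :: nat where "Rpos \<equiv> 2"
abbreviation (input) Rvert :: nat where "Rvert \<equiv> 3"
abbreviation (input) Rdeg :: nat where "Rdeg \<equiv> 4"
abbreviation (input) Rm :: nat where "Rm \<equiv> 5"
abbreviation (input) RA :: nat where "RA \<equiv> 6"
abbreviation (input) RB :: nat where "RB \<equiv> 7"
abbreviation (input) RrankA :: nat where "RrankA \<equiv> 8"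
abbreviation (input) RrankB :: nat where "RrankB \<equiv> 9"
abbreviation (input) Rlq :: nat where "Rlq \<equiv> 10"
abbreviation (input) Ruq :: nat where "Ruq \<equiv> 11"
abbreviation (input) Rlev :: nat where "Rlev \<equiv> 12"
abbreviation (input) Roff :: nat where "Roff \<equiv> 13"
abbreviation (input) Ri :: nat where "Ri \<equiv> 14"
abbreviation (input) Rj :: nat where "Rj \<equiv> 15"
abbreviation (input) Rk :: nat where "Rk \<equiv> 16"
abbreviation (input) Rcnt :: nat where "Rcnt \<equiv> 17"
abbreviation (input) Rh :: nat where "Rh \<equiv> 18"
abbreviation (input) Re :: nat where "Re \<equiv> 19"
abbreviation (input) Rx :: nat where "Rx \<equiv> 20"
abbreviation (input) Ry :: nat where "Ry \<equiv> 21"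

definition read_vertex :: com where
  "read_vertex =
    Seq (assign Rvert (entry 0 Rpos))
   (Seq (Assign Rlq (var Rvert) (Cell 0 (Plus (var Rpos) (Const 1))))
   (Seq (Assign Ruq (var Rvert) (Cell 0 (Plus (var Rpos) (Const 2))))
   (Seq (assign Rdeg (Cell 0 (Plus (var Rpos) (Const 3))))
        (incr Rpos 4))))"

definition add_edge :: com where
  "add_edge =
    Seq (Assign RA (var Rm) (var Rvert))
   (Seq (Assign RB (var Rm) (entry 0 Rpos))
   (Seq (Assign RrankA (var Rm) (var Rj))
   (Seq (incr Rm 1) (incr Rpos 1))))"

definition read_sideA :: com where
  "read_sideA = For Ri (Cell 0 (Const 1)) (Seq read_vertex (For Rj (var Rdeg) add_edge))"

text \<open>The edges are numbered while \<open>sideA\<close> is read. There is no table from pairs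
  to numbers, so the edge of a \<open>sideB\<close> entry is found by linear search.\<close>

definition add_rank :: com where
  "add_rank =
    Seq (For Rk (var Rm)
      (If (And (Eq (entry RB Rk) (var Rvert)) (Eq (entry RA Rk) (entry 0 Rpos)))
        (Assign RrankB (var Rk) (var Rj)) Skip))
    (incr Rpos 1)"

definition read_sideB :: com where
  "read_sideB = For Ri (Cell 0 (Const 2)) (Seq read_vertex (For Rj (var Rdeg) add_rank))"

lemma bij_betw_lessThan_Suc:
  assumes "bij_betw f {..<n} F" "x \<notin> F" "\<And>k. k < n \<Longrightarrow> g k = f k" "g n = x"
  shows "bij_betw g {..<Suc n} (insert x F)"
proof -
  have "g ` {..<n} = F" "inj_on g {..<n}"
    using assms(1,3) by (auto simp: bij_betw_def inj_on_def)
  then show ?thesis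
    using assms(2,4) by (auto simp: bij_betw_def lessThan_Suc)
qed

section \<open>Layout of the encoded instance\<close>

locale encoded_instance = quota_instance G for G :: "nat quota_graph"
begin

definition as :: "nat list" where "as = sorted_list_of_set (sideA G)"
definition bs :: "nat list" where "bs = sorted_list_of_set (sideB G)"

definition input :: "nat \<Rightarrow> nat" where
  "input = init_state (encode_graph G) 0"

definition size_in :: nat where
  "size_in = length (encode_graph G)"

text \<open>The cell of register 0 where vertex \<open>i\<close> begins; the 3 skips the length of
  the input and the sizes of the two sides.\<close>

definition offset :: "nat \<Rightarrow> nat" where
  "offset i = 3 + length (concat (map (encode_vertex G) (take i (as @ bs))))"

lemma finite_sides: "finite (sideA G)" "finite (sideB G)"
  using bip by (auto simp: bipartite_quota_graph_def)

lemma as_bs: "set as = sideA G" "set bs = sideB G" "distinct as" "distinct bs"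
  "length as = card (sideA G)" "length bs = card (sideB G)"
  using finite_sides by (auto simp: as_def bs_def)

lemma encode_graph_eq:
  "encode_graph G = [length as, length bs] @ concat (map (encode_vertex G) (as @ bs))"
  by (simp add: encode_graph_def as_bs) (simp add: as_def bs_def)

lemma input_simps: "input 0 = size_in" "input (Suc 0) = length as" "input 2 = length bs"
  by (auto simp: input_def init_state_def size_in_def encode_graph_eq)

lemma input_nth: "p < size_in \<Longrightarrow> input (Suc p) = encode_graph G ! p"
  by (simp add: input_def init_state_def size_in_def)

lemma offset_0: "offset 0 = 3"
  by (simp add: offset_def)

lemma offset_Suc:
  "i < length (as @ bs) \<Longrightarrow> offset (Suc i) = offset i + 4 + length (prefs G ((as @ bs) ! i))"
  unfolding offset_def by (subst take_Suc_conv_app_nth) (simp_all add: encode_vertex_def)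

lemma input_offset:
  assumes i: "i < length (as @ bs)" and j: "j < 4 + length (prefs G ((as @ bs) ! i))"
  shows "input (offset i + j) = encode_vertex G ((as @ bs) ! i) ! j"
proof -
  let ?vs = "as @ bs" and ?e = "encode_vertex G"
  let ?L = "concat (map ?e (take i ?vs))"
  have "concat (map ?e ?vs)
      = ?L @ ?e (?vs ! i) @ concat (map ?e (drop (Suc i) ?vs))"
    by (subst id_take_nth_drop[OF i]) simp
  then have eq: "encode_graph G
      = ([length as, length bs] @ ?L) @ ?e (?vs ! i) @ concat (map ?e (drop (Suc i) ?vs))"
    unfolding encode_graph_eq by simp
  have len: "j < length (?e (?vs ! i))" using j by (simp add: encode_vertex_def)
  have p: "offset i + j = Suc (length ([length as, length bs] @ ?L) + j)"
    by (simp add: offset_def)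
  have "length ([length as, length bs] @ ?L) + j < size_in"
    unfolding size_in_def eq using len by simp
  then have "input (offset i + j) = encode_graph G ! (length ([length as, length bs] @ ?L) + j)"
    unfolding p by (rule input_nth)
  also have "\<dots> = ?e (?vs ! i) ! j"
    unfolding eq nth_append_length_plus using len by (simp add: nth_append)
  finally show ?thesis .
qed

lemma input_header:
  assumes "i < length (as @ bs)"
  shows "input (offset i) = (as @ bs) ! i" "input (offset i + 1) = lquota G ((as @ bs) ! i)"
    "input (offset i + 2) = uquota G ((as @ bs) ! i)"
    "input (offset i + 3) = length (prefs G ((as @ bs) ! i))"
    "j < length (prefs G ((as @ bs) ! i)) \<Longrightarrow> input (offset i + 4 + j) = prefs G ((as @ bs) ! i) ! j"
  using input_offset[OF assms, of 0] input_offset[OF assms, of 1] input_offset[OF assms, of 2]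
    input_offset[OF assms, of 3] input_offset[OF assms, of "4 + j"]
  by (simp_all add: encode_vertex_def nth_append numeral_eq_Suc)

lemma sum_degrees: "(\<Sum>v\<in>verts G. length (prefs G v)) = 2 * card (edges G)"
proof -
  have "length (prefs G v) = card (nbrs (edges G) v)" if "v \<in> verts G" for v
    using distinct_card[OF distinct_prefs[OF that]] set_prefs[OF that] by simp
  then show ?thesis using sum_card_nbrs[of "edges G"] by simp
qed

lemma length_encode_vertex: "length (encode_vertex G v) = 4 + length (prefs G v)"
  by (simp add: encode_vertex_def)

text \<open>Each edge occurs in two preference lists. In particular the length of the input exceeds
  \<open>2 * card (edges G) + 1\<close>, which makes it a possible value of
  \<open>T\<close>.\<close>

lemma size_in_eq: "size_in = 2 + 4 * (length as + length bs) + 2 * card (edges G)"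
proof -
  have "size_in = 2 + (\<Sum>v\<leftarrow>as @ bs. 4 + length (prefs G v))"
    by (simp add: size_in_def encode_graph_eq length_concat length_encode_vertex comp_def)
  also have "(\<Sum>v\<leftarrow>as @ bs. 4 + length (prefs G v)) = (\<Sum>v\<in>verts G. 4 + length (prefs G v))"
    using as_bs sides_disjoint by (subst sum_list_distinct_conv_sum_set) (auto simp: verts_def)
  also have "\<dots> = 4 * card (verts G) + 2 * card (edges G)"
    by (simp add: sum.distrib sum_degrees)
  also have "card (verts G) = length as + length bs"
    using finite_sides sides_disjoint by (simp add: verts_def card_Un_disjoint as_bs)
  finally show ?thesis by simp
qed

lemma length_prefs_le: "v \<in> verts G \<Longrightarrow> length (prefs G v) \<le> size_in"
  using member_le_sum[of v "verts G" "\<lambda>v. length (prefs G v)"] finite_verts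
  by (simp add: sum_degrees size_in_eq)

section \<open>Correctness of the parser\<close>

definition rankA_ok :: "state \<Rightarrow> nat \<Rightarrow> bool" where
  "rankA_ok s k \<longleftrightarrow> s RrankA k < length (prefs G (s RA k)) \<and> prefs G (s RA k) ! s RrankA k = s RB k"

definition rankB_ok :: "state \<Rightarrow> nat \<Rightarrow> bool" where
  "rankB_ok s k \<longleftrightarrow> s RrankB k < length (prefs G (s RB k)) \<and> prefs G (s RB k) ! s RrankB k = s RA k"

definition edge_at :: "state \<Rightarrow> nat \<Rightarrow> nat \<times> nat" where
  "edge_at s k = (s RA k, s RB k)"

definition parsed :: "(nat \<times> nat) set \<Rightarrow> nat set \<Rightarrow> state \<Rightarrow> bool" where
  "parsed F V s \<longleftrightarrow> s 0 = input \<and> s 1 = (\<lambda>_. 0) \<and> s Rlev = (\<lambda>_. 0) \<and>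
     (\<forall>v\<in>V. s Rlq v = lquota G v \<and> s Ruq v = uquota G v) \<and>
     bij_betw (edge_at s) {..<s Rm 0} F \<and> (\<forall>k<s Rm 0. rankA_ok s k)"

lemma wp_read_vertex:
  assumes s: "parsed F V s" "s Rpos 0 = offset i" and i: "i < length (as @ bs)"
  defines "v \<equiv> (as @ bs) ! i"
  shows "wp read_vertex (\<lambda>t s'. t \<le> 5 \<and> (parsed F (insert v V) s' \<and>
    s' Rpos 0 = offset i + 4 \<and> s' Rvert 0 = v \<and> s' Rdeg 0 = length (prefs G v) \<and>
    (\<forall>r. r \<notin> {Rpos, Rvert, Rdeg, Rlq, Ruq} \<longrightarrow> s' r = s r))) s"
  using s input_header[OF i]
  by (auto simp: read_vertex_def update_def parsed_def v_def rankA_ok_def edge_at_def[abs_def])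

lemma edge_of_prefs:
  "a \<in> sideA G \<Longrightarrow> (a, b) \<in> edges G \<longleftrightarrow> b \<in> set (prefs G a)"
  "b \<in> sideB G \<Longrightarrow> (a, b) \<in> edges G \<longleftrightarrow> a \<in> set (prefs G b)"
  using set_prefs[of a] set_prefs[of b] nbrs_sideA[of "edges G" a] nbrs_sideB[of "edges G" b]
  by (auto simp: verts_def)

definition edges_read :: "nat \<Rightarrow> nat \<Rightarrow> (nat \<times> nat) set" where
  "edges_read i j = {(a, b) \<in> edges G. a \<in> set (take i as)} \<union>
     (\<lambda>j'. (as ! i, prefs G (as ! i) ! j')) ` {..<j}"

lemma edges_read_Suc:
  assumes i: "i < length as" and j: "j < length (prefs G (as ! i))"
  shows "(as ! i, prefs G (as ! i) ! j) \<notin> edges_read i j"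
    "edges_read i (Suc j) = insert (as ! i, prefs G (as ! i) ! j) (edges_read i j)"
proof -
  have "as ! i \<notin> set (take i as)"
    using i as_bs(3) by (auto simp: in_set_conv_nth nth_eq_iff_index_eq)
  moreover have "as ! i \<in> verts G" using nth_mem[OF i] by (simp add: as_bs verts_def)
  ultimately show "(as ! i, prefs G (as ! i) ! j) \<notin> edges_read i j"
    using j distinct_prefs[of "as ! i"] by (auto simp: edges_read_def nth_eq_iff_index_eq)
qed (auto simp: edges_read_def lessThan_Suc)

lemma edges_read_next:
  assumes "i < length as"
  shows "edges_read i (length (prefs G (as ! i))) = edges_read (Suc i) 0"
proof -
  have a: "as ! i \<in> sideA G" using nth_mem[OF assms] by (simp add: as_bs)
  have "(\<lambda>j'. (as ! i, prefs G (as ! i) ! j')) ` {..<length (prefs G (as ! i))}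
      = Pair (as ! i) ` set (prefs G (as ! i))"
  proof -
    have "set (prefs G (as ! i)) = (!) (prefs G (as ! i)) ` {..<length (prefs G (as ! i))}"
      by (auto simp: set_conv_nth)
    then show ?thesis by (simp add: image_image)
  qed
  also have "\<dots> = {(a, b) \<in> edges G. a = as ! i}"
    using edge_of_prefs(1)[OF a] by auto
  finally show ?thesis
    using assms by (auto simp: edges_read_def take_Suc_conv_app_nth)
qed

lemma edges_read_all: "edges_read 0 0 = {}" "edges_read (length as) 0 = edges G"
  using edge_sides by (auto simp: edges_read_def as_bs)

lemma wp_read_sideA:
  assumes s: "parsed {} {} s" "s Rpos 0 = 3"
  shows "wp read_sideA (\<lambda>t s'. t \<le> size_in * (5 + (size_in * 7 + 2) + 2) + 2 \<and>
    (parsed (edges G) (sideA G) s' \<and> s' Rpos 0 = offset (length as))) s"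
proof -
  define I where "I i s \<longleftrightarrow> parsed (edges_read i 0) (set (take i as)) s \<and> s Rpos 0 = offset i" for i s
  have "wp read_sideA (\<lambda>t s'. t \<le> length as * (5 + (size_in * 7 + 2) + 2) + 2 \<and>
      I (length as) s' \<and> s' Ri 0 = length as) s"
    unfolding read_sideA_def
  proof (rule wp_For)
    show "I 0 (update s Ri 0 0)"
      using s by (auto simp: I_def parsed_def update_def edges_read_all offset_0 rankA_ok_def edge_at_def[abs_def])
    show "aval (Cell 0 (Const 1)) s' = length as" if "I k s'" for k s'
      using that by (simp add: I_def parsed_def input_simps)
    fix i s1 assume i: "i < length as" and I: "I i s1" and si: "s1 Ri 0 = i"
    define v where "v = as ! i"
    define d where "d = length (prefs G v)"
    have vi: "(as @ bs) ! i = v" using i by (simp add: v_def nth_append)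
    have i': "i < length (as @ bs)" using i by simp
    have vV: "v \<in> verts G" using nth_mem[OF i] by (simp add: v_def as_bs verts_def)
    define J where "J j s \<longleftrightarrow> parsed (edges_read i j) (set (take (Suc i) as)) s \<and>
      s Rpos 0 = offset i + 4 + j \<and> s Rvert 0 = v \<and> s Rdeg 0 = d \<and> s Ri 0 = i" for j s
    have "wp (For Rj (var Rdeg) add_edge)
      (\<lambda>t s'. t \<le> d * (5 + 2) + 2 \<and> J d s' \<and> s' Rj 0 = d) s2" if J: "J 0 s2" for s2
    proof (rule wp_For)
      show "J 0 (update s2 Rj 0 0)"
        using J by (auto simp: J_def parsed_def update_def rankA_ok_def edge_at_def[abs_def])
      show "aval (var Rdeg) s' = d" if "J k s'" for k s'
        using that by (simp add: J_def)
      fix j s3 assume j: "j < d" and J: "J j s3" and sj: "s3 Rj 0 = j"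
      have inp: "input (offset i + 4 + j) = prefs G v ! j"
        using input_header(5)[OF i', of j] j by (simp add: vi d_def)
      define s4 where "s4 = s3(RA := (s3 RA)(s3 Rm 0 := v), RB := (s3 RB)(s3 Rm 0 := prefs G v ! j),
        RrankA := (s3 RrankA)(s3 Rm 0 := j), Rm := (s3 Rm)(0 := Suc (s3 Rm 0)),
        Rpos := (s3 Rpos)(0 := offset i + 4 + Suc j), Rj := (s3 Rj)(0 := Suc j))"
      have "bij_betw (edge_at s4) {..<Suc (s3 Rm 0)} (insert (v, prefs G v ! j) (edges_read i j))"
      proof (rule bij_betw_lessThan_Suc)
        show "bij_betw (edge_at s3) {..<s3 Rm 0} (edges_read i j)"
          using J by (simp add: J_def parsed_def)
        show "(v, prefs G v ! j) \<notin> edges_read i j"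
          using edges_read_Suc(1)[OF i, of j] j by (simp add: v_def d_def)
      qed (auto simp: s4_def edge_at_def)
      then have "bij_betw (edge_at s4) {..<Suc (s3 Rm 0)} (edges_read i (Suc j))"
        using edges_read_Suc(2)[OF i, of j] j by (simp add: v_def d_def)
      moreover have "\<forall>k<Suc (s3 Rm 0). rankA_ok s4 k"
        using J j by (auto simp: J_def parsed_def rankA_ok_def s4_def d_def less_Suc_eq)
      ultimately have "J (Suc j) s4"
        using J by (simp add: J_def parsed_def s4_def)
      moreover have "s4 = update (s3(RA := (s3 RA)(s3 Rm 0 := v), RB := (s3 RB)(s3 Rm 0 := prefs G v ! j),
        RrankA := (s3 RrankA)(s3 Rm 0 := j), Rm := (s3 Rm)(0 := Suc (s3 Rm 0)),
        Rpos := (s3 Rpos)(0 := offset i + 4 + Suc j))) Rj 0 (Suc j)"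
        by (simp add: s4_def update_def)
      ultimately show "wp add_edge
        (\<lambda>u s'. u \<le> 5 \<and> s' Rj 0 = j \<and> J (Suc j) (update s' Rj 0 (Suc j))) s3"
        using J inp sj by (simp add: add_edge_def update_def J_def parsed_def)
    qed
    moreover have "d \<le> size_in" using length_prefs_le[OF vV] by (simp add: d_def)
    ultimately have inner: "wp (For Rj (var Rdeg) add_edge)
      (\<lambda>t s'. t \<le> size_in * 7 + 2 \<and> (J d s' \<and> s' Rj 0 = d)) s2" if "J 0 s2" for s2
      using that by (fastforce elim!: wp_mono intro: order.trans)
    have next_I: "I (Suc i) (update s' Ri 0 (Suc i))" if "J d s'" for s'
      using that edges_read_next[OF i] offset_Suc[OF i'] vi i
      by (auto simp: I_def J_def parsed_def update_def d_def v_def rankA_ok_def edge_at_def[abs_def])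
    have "wp (Seq read_vertex (For Rj (var Rdeg) add_edge))
      (\<lambda>t s'. t \<le> 5 + (size_in * 7 + 2) \<and> (J d s' \<and> s' Rj 0 = d)) s1"
    proof (rule wp_SeqI[where P = "J 0"])
      have "insert v (set (take i as)) = set (take (Suc i) as)"
        using i by (simp add: take_Suc_conv_app_nth v_def)
      then show "wp read_vertex (\<lambda>t s'. t \<le> 5 \<and> J 0 s') s1"
        using I si by (intro wp_mono[OF wp_read_vertex[OF _ _ i']]) (auto simp: I_def J_def vi d_def)
    qed (rule inner)
    then show "wp (Seq read_vertex (For Rj (var Rdeg) add_edge))
      (\<lambda>u s'. u \<le> 5 + (size_in * 7 + 2) \<and> s' Ri 0 = i \<and> I (Suc i) (update s' Ri 0 (Suc i))) s1"
      by (rule wp_mono) (use next_I in \<open>auto simp: J_def\<close>)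
  qed
  moreover have "length as \<le> size_in" by (simp add: size_in_eq)
  then have "length as * (5 + (size_in * 7 + 2) + 2) + 2 \<le> size_in * (5 + (size_in * 7 + 2) + 2) + 2"
    by (intro add_right_mono mult_right_mono) auto
  ultimately show ?thesis
    using edges_read_all(2) by (auto simp: I_def as_bs elim!: wp_mono intro: order.trans)
qed

text \<open>The part of the parsed data that the main loop preserves; the levels are left out
  because they change.\<close>

definition table :: "state \<Rightarrow> bool" where
  "table s \<longleftrightarrow> s 0 = input \<and> s 1 = (\<lambda>_. 0) \<and>
     (\<forall>v\<in>verts G. s Rlq v = lquota G v \<and> s Ruq v = uquota G v) \<and>
     bij_betw (edge_at s) {..<s Rm 0} (edges G) \<and>
     (\<forall>k<s Rm 0. rankA_ok s k \<and> rankB_ok s k)"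

lemma card_parsed: "parsed F V s \<Longrightarrow> s Rm 0 = card F"
  by (auto simp: parsed_def dest: bij_betw_same_card)

text \<open>Overwriting is harmless: a cell is changed only if its edge has exactly the two ends
  being read, and then \<open>j\<close> is a correct rank. Ranks found earlier thus remain
  valid.\<close>

lemma wp_add_rank:
  assumes s: "parsed F V s" "s Rpos 0 = p" "s Rj 0 = j" "s Rvert 0 = v"
    and j: "j < length (prefs G v)" and p: "input p = prefs G v ! j"
  shows "wp add_rank (\<lambda>t s'. t \<le> card F * 4 + 3 \<and> (parsed F V s' \<and> s' Rpos 0 = Suc p \<and>
    (\<forall>r. r \<notin> {Rpos, Rk, RrankB} \<longrightarrow> s' r = s r) \<and>
    (\<forall>k<card F. rankB_ok s k \<or> s RB k = v \<and> s RA k = prefs G v ! j \<longrightarrow> rankB_ok s' k))) s"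
proof -
  define K where "K k' s' \<longleftrightarrow> (\<forall>r. r \<notin> {Rk, RrankB} \<longrightarrow> s' r = s r) \<and>
    (\<forall>k<card F. rankB_ok s k \<or> k < k' \<and> s RB k = v \<and> s RA k = prefs G v ! j \<longrightarrow> rankB_ok s' k)"
    for k' s'
  have m: "s Rm 0 = card F" by (rule card_parsed[OF s(1)])
  have "wp (For Rk (var Rm)
      (If (And (Eq (entry RB Rk) (var Rvert)) (Eq (entry RA Rk) (entry 0 Rpos)))
        (Assign RrankB (var Rk) (var Rj)) Skip))
      (\<lambda>t s'. t \<le> card F * (2 + 2) + 2 \<and> K (card F) s' \<and> s' Rk 0 = card F) s"
  proof (rule wp_For)
    show "K 0 (update s Rk 0 0)"
      by (auto simp: K_def update_def rankB_ok_def)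
    show "aval (var Rm) s' = card F" if "K k s'" for k s'
      using that m by (simp add: K_def)
    fix k s1 assume k: "k < card F" and K: "K k s1" and sk: "s1 Rk 0 = k"
    have eqs: "s1 RB = s RB" "s1 RA = s RA" "s1 Rvert = s Rvert" "s1 0 = s 0" "s1 Rpos = s Rpos" "s1 Rj = s Rj"
      using K by (simp_all add: K_def)
    have inp: "s 0 p = prefs G v ! j" using s(1) p by (simp add: parsed_def)
    show "wp (If (And (Eq (entry RB Rk) (var Rvert)) (Eq (entry RA Rk) (entry 0 Rpos)))
        (Assign RrankB (var Rk) (var Rj)) Skip)
      (\<lambda>u s'. u \<le> 2 \<and> s' Rk 0 = k \<and> K (Suc k) (update s' Rk 0 (Suc k))) s1"
    proof (cases "s RB k = v \<and> s RA k = prefs G v ! j")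
      case True
      then have "K (Suc k) (update (update s1 RrankB k j) Rk 0 (Suc k))"
        using K j by (auto simp: K_def update_def rankB_ok_def less_Suc_eq)
      then show ?thesis
        using True sk s by (simp add: eqs inp update_def)
    next
      case False
      then have "K (Suc k) (update s1 Rk 0 (Suc k))"
        using K by (auto simp: K_def update_def rankB_ok_def less_Suc_eq)
      moreover have "s RB k \<noteq> v \<or> s RA k \<noteq> prefs G v ! j" using False by blast
      ultimately show ?thesis
        using sk s by (auto simp: eqs inp)
    qed
  qed
  then show ?thesis
    unfolding add_rank_def wp_Seq
    by (rule wp_mono)
      (use s in \<open>auto simp: K_def update_def parsed_def rankA_ok_def rankB_ok_def edge_at_def[abs_def]\<close>)
qed

lemma wp_read_sideB:
  assumes s: "parsed (edges G) (sideA G) s" "s Rpos 0 = offset (length as)"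
  shows "wp read_sideB (\<lambda>t s'. t \<le> size_in * (5 + (size_in * ((size_in * 4 + 3) + 2) + 2) + 2) + 2 \<and>
    (table s' \<and> s' Rlev = (\<lambda>_. 0))) s"
proof -
  define I where "I i s \<longleftrightarrow> parsed (edges G) (sideA G \<union> set (take i bs)) s \<and>
    s Rpos 0 = offset (length as + i) \<and> (\<forall>k<card (edges G). s RB k \<in> set (take i bs) \<longrightarrow> rankB_ok s k)"
    for i s
  have m_le: "card (edges G) \<le> size_in" by (simp add: size_in_eq)
  have "wp read_sideB (\<lambda>t s'. t \<le> length bs * (5 + (size_in * ((size_in * 4 + 3) + 2) + 2) + 2) + 2 \<and>
      I (length bs) s' \<and> s' Ri 0 = length bs) s"
    unfolding read_sideB_def
  proof (rule wp_For)
    show "I 0 (update s Ri 0 0)"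
      using s by (auto simp: I_def parsed_def update_def rankA_ok_def edge_at_def[abs_def])
    show "aval (Cell 0 (Const 2)) s' = length bs" if "I k s'" for k s'
      using that by (simp add: I_def parsed_def input_simps)
    fix i s1 assume i: "i < length bs" and I: "I i s1" and si: "s1 Ri 0 = i"
    define v where "v = bs ! i"
    define d where "d = length (prefs G v)"
    have vi: "(as @ bs) ! (length as + i) = v" by (simp add: v_def)
    have i': "length as + i < length (as @ bs)" using i by simp
    have vB: "v \<in> sideB G" using nth_mem[OF i] by (simp add: v_def as_bs)
    then have vV: "v \<in> verts G" by (simp add: verts_def)
    have take_Suc: "set (take (Suc i) bs) = insert v (set (take i bs))"
      using i by (simp add: take_Suc_conv_app_nth v_def)
    define J where "J j s \<longleftrightarrow> parsed (edges G) (sideA G \<union> set (take (Suc i) bs)) s \<and>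
      s Rpos 0 = offset (length as + i) + 4 + j \<and> s Rvert 0 = v \<and> s Rdeg 0 = d \<and> s Ri 0 = i \<and>
      (\<forall>k<card (edges G). s RB k \<in> set (take i bs) \<or> s RB k = v \<and> s RA k \<in> set (take j (prefs G v))
        \<longrightarrow> rankB_ok s k)" for j s
    have loop: "wp (For Rj (var Rdeg) add_rank)
      (\<lambda>t s'. t \<le> d * ((size_in * 4 + 3) + 2) + 2 \<and> J d s' \<and> s' Rj 0 = d) s2" if J: "J 0 s2" for s2
    proof (rule wp_For)
      show "J 0 (update s2 Rj 0 0)"
        using J by (auto simp: J_def parsed_def update_def rankA_ok_def rankB_ok_def edge_at_def[abs_def])
      show "aval (var Rdeg) s' = d" if "J k s'" for k s'
        using that by (simp add: J_def)
      fix j s3 assume j: "j < d" and J: "J j s3" and sj: "s3 Rj 0 = j"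
      have inp: "input (offset (length as + i) + 4 + j) = prefs G v ! j"
        using input_header(5)[OF i', of j] j unfolding vi d_def by simp
      have step: "J (Suc j) (update s' Rj 0 (Suc j))"
        if "parsed (edges G) (sideA G \<union> set (take (Suc i) bs)) s'"
          "s' Rpos 0 = Suc (offset (length as + i) + 4 + j)"
          "\<forall>r. r \<notin> {Rpos, Rk, RrankB} \<longrightarrow> s' r = s3 r"
          "\<forall>k<card (edges G). rankB_ok s3 k \<or> s3 RB k = v \<and> s3 RA k = prefs G v ! j \<longrightarrow> rankB_ok s' k"
        for s'
        using that J j
        by (auto simp: J_def d_def take_Suc_conv_app_nth parsed_def update_def rankA_ok_def rankB_ok_def edge_at_def[abs_def])
      have "wp add_rank (\<lambda>t s'. t \<le> card (edges G) * 4 + 3 \<and>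
        (parsed (edges G) (sideA G \<union> set (take (Suc i) bs)) s' \<and>
          s' Rpos 0 = Suc (offset (length as + i) + 4 + j) \<and>
          (\<forall>r. r \<notin> {Rpos, Rk, RrankB} \<longrightarrow> s' r = s3 r) \<and>
          (\<forall>k<card (edges G). rankB_ok s3 k \<or> s3 RB k = v \<and> s3 RA k = prefs G v ! j
             \<longrightarrow> rankB_ok s' k))) s3"
        using J j sj inp by (intro wp_add_rank) (auto simp: J_def d_def)
      then show "wp add_rank (\<lambda>u s'. u \<le> size_in * 4 + 3 \<and> s' Rj 0 = j \<and> J (Suc j) (update s' Rj 0 (Suc j))) s3"
        by (rule wp_mono) (use step sj m_le in auto)
    qed
    have "d \<le> size_in" using length_prefs_le[OF vV] by (simp add: d_def)
    then have d_le: "d * ((size_in * 4 + 3) + 2) + 2 \<le> size_in * ((size_in * 4 + 3) + 2) + 2"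
      by (intro add_right_mono mult_right_mono) auto
    have inner: "wp (For Rj (var Rdeg) add_rank)
      (\<lambda>t s'. t \<le> size_in * ((size_in * 4 + 3) + 2) + 2 \<and> (J d s' \<and> s' Rj 0 = d)) s2" if "J 0 s2" for s2
      using loop[OF that] d_le by (rule wp_time_mono)
    \<comment> \<open>The list of \<open>v\<close> names every edge at \<open>v\<close>, so after
      its last entry no edge at \<open>v\<close> lacks a rank.\<close>
    have in_prefs: "s' RA k \<in> set (prefs G v)"
      if "parsed (edges G) V s'" "k < card (edges G)" "s' RB k = v" for V s' k
    proof -
      have "edge_at s' k \<in> edges G"
        using that card_parsed[OF that(1)] by (auto simp: parsed_def bij_betw_def)
      then show ?thesis using that(3) edge_of_prefs(2)[OF vB] by (simp add: edge_at_def)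
    qed
    have next_I: "I (Suc i) (update s' Ri 0 (Suc i))" if J: "J d s'" for s'
    proof -
      have "rankB_ok s' k" if "k < card (edges G)" "s' RB k \<in> set (take (Suc i) bs)" for k
        using J that in_prefs[of _ s' k] unfolding J_def take_Suc by (auto simp: d_def)
      then show ?thesis
        using J offset_Suc[OF i'] vi
        by (auto simp: I_def J_def parsed_def update_def d_def rankA_ok_def rankB_ok_def edge_at_def[abs_def])
    qed
    have "wp (Seq read_vertex (For Rj (var Rdeg) add_rank))
      (\<lambda>t s'. t \<le> 5 + (size_in * ((size_in * 4 + 3) + 2) + 2) \<and> (J d s' \<and> s' Rj 0 = d)) s1"
    proof (rule wp_SeqI[where P = "J 0"])
      have "wp read_vertex (\<lambda>t s'. t \<le> 5 \<and> (parsed (edges G) (insert v (sideA G \<union> set (take i bs))) s' \<and>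
          s' Rpos 0 = offset (length as + i) + 4 \<and> s' Rvert 0 = v \<and> s' Rdeg 0 = d \<and>
          (\<forall>r. r \<notin> {Rpos, Rvert, Rdeg, Rlq, Ruq} \<longrightarrow> s' r = s1 r))) s1"
        using wp_read_vertex[of "edges G" "sideA G \<union> set (take i bs)" s1 "length as + i"] I i'
        unfolding vi d_def by (simp add: I_def)
      then show "wp read_vertex (\<lambda>t s'. t \<le> 5 \<and> J 0 s') s1"
        by (rule wp_mono) (use I si in \<open>auto simp: I_def J_def take_Suc rankB_ok_def\<close>)
    qed (rule inner)
    then show "wp (Seq read_vertex (For Rj (var Rdeg) add_rank))
      (\<lambda>u s'. u \<le> 5 + (size_in * ((size_in * 4 + 3) + 2) + 2) \<and> s' Ri 0 = i \<and>
        I (Suc i) (update s' Ri 0 (Suc i))) s1"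
      by (rule wp_mono) (use next_I in \<open>auto simp: J_def\<close>)
  qed
  note loop = this
  have "length bs \<le> size_in" by (simp add: size_in_eq)
  then have time: "length bs * (5 + (size_in * ((size_in * 4 + 3) + 2) + 2) + 2) + 2
      \<le> size_in * (5 + (size_in * ((size_in * 4 + 3) + 2) + 2) + 2) + 2"
    by (intro add_right_mono mult_right_mono) auto
  have post: "table s' \<and> s' Rlev = (\<lambda>_. 0)" if I: "I (length bs) s'" for s'
  proof -
    have m: "s' Rm 0 = card (edges G)" using I card_parsed by (auto simp: I_def)
    have "s' RB k \<in> sideB G" if "k < card (edges G)" for k
    proof -
      have "edge_at s' k \<in> edges G"
        using that m I by (auto simp: I_def parsed_def bij_betw_def)
      then show ?thesis using edge_sides by (simp add: edge_at_def)
    qed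
    then show ?thesis
      using I m by (auto simp: I_def table_def parsed_def as_bs verts_def)
  qed
  show ?thesis
    using loop time by (rule wp_time_mono) (simp add: post)
qed

end

section \<open>The main loop\<close>

definition count_at_A :: com where
  "count_at_A = Count Rk Rcnt (var Rm) (And (Eq (entry RA Rk) (entry RA Rh))
    (Or (Less (entry Rlev Rk) (entry Rlev Rh))
      (And (Eq (entry Rlev Rk) (entry Rlev Rh)) (Less (entry RrankA Rk) (entry RrankA Rh)))))"

text \<open>\<open>var 0\<close> is the length of the input, which the machine finds ready in
  register 0 and uses as \<open>T\<close>.\<close>

definition is_offered :: bexp where
  "is_offered = And (Less (entry Rlev Rh) (Plus (var 0) (var 0)))
    (Or (And (Not (Less (var 0) (entry Rlev Rh))) (Less (var Rcnt) (Cell Ruq (entry RA Rh))))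
      (And (Less (var 0) (entry Rlev Rh)) (Less (var Rcnt) (Cell Rlq (entry RA Rh)))))"

definition compute_offers :: com where
  "compute_offers = For Rh (var Rm) (Seq count_at_A
    (If is_offered (Assign Roff (var Rh) (Const 1)) (Assign Roff (var Rh) (Const 0))))"

text \<open>The comparison of levels is reversed, since \<open>b\<close> measures them by
  \<open>2 * T - 1 - l\<close>.\<close>

definition count_at_B :: com where
  "count_at_B = Count Rk Rcnt (var Rm) (And (And (Eq (entry RB Rk) (entry RB Re)) (Eq (entry Roff Rk) (Const 1)))
    (Or (Less (entry Rlev Re) (entry Rlev Rk))
      (And (Eq (entry Rlev Rk) (entry Rlev Re)) (Less (entry RrankB Rk) (entry RrankB Re)))))"

text \<open>The level \<open>2 * T - 1 - l\<close> on the side of \<open>B\<close> is at most \<open>T\<close> iff \<open>T < l + 2\<close>.\<close>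

definition is_rejected :: bexp where
  "is_rejected = And (Eq (entry Roff Re) (Const 1))
    (Or (And (Less (var 0) (Plus (entry Rlev Re) (Const 2))) (Not (Less (var Rcnt) (Cell Ruq (entry RB Re)))))
      (And (Not (Less (var 0) (Plus (entry Rlev Re) (Const 2)))) (Not (Less (var Rcnt) (Cell Rlq (entry RB Re))))))"

text \<open>All offers are recomputed before each test, so the loop needs no invariant about
  \<open>Roff\<close>.\<close>

definition reject_step :: com where
  "reject_step = Seq compute_offers (Seq count_at_B
    (If is_rejected (Assign Rlev (var Re) (Plus (entry Rlev Re) (Const 1))) Skip))"

text \<open>Two nested loops produce the \<open>2 * T * T\<close> rounds that the machine cannot
  compute by multiplication. Their number is fixed in advance and exceeds the largest possible sum
  of levels.\<close>

definition reject_loop :: com where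
  "reject_loop = For Rx (Plus (var 0) (var 0)) (For Ry (var 0) (For Re (var Rm) reject_step))"

definition write_offers :: com where
  "write_offers = For Rk (var Rm) (If (Eq (entry Roff Rk) (Const 1))
    (Seq (Assign 1 (Plus (var 1) (Const 1)) (entry RA Rk))
    (Seq (Assign 1 (Plus (var 1) (Const 2)) (entry RB Rk))
         (incr 1 2))) Skip)"

text \<open>The last \<open>compute_offers\<close> is required because \<open>Roff\<close> need not
  reflect the final levels.\<close>

definition popular_critical_program :: com where
  "popular_critical_program = Seq (assign Rpos (Const 3)) (Seq read_sideA (Seq read_sideB
    (Seq reject_loop (Seq compute_offers write_offers))))"

lemma card_indices:
  assumes "bij_betw f {..<m :: nat} F"
  shows "card {k. k < m \<and> P (f k)} = card {p \<in> F. P p}"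
proof (rule bij_betw_same_card)
  show "bij_betw f {k. k < m \<and> P (f k)} {p \<in> F. P p}"
    using assms by (auto simp: bij_betw_def inj_on_def image_iff)
qed

section \<open>Correctness and running time of the main loop\<close>

context encoded_instance
begin

abbreviation T :: nat where "T \<equiv> size_in"

abbreviation m :: nat where "m \<equiv> card (edges G)"

definition levels_are :: "(nat \<times> nat \<Rightarrow> nat) \<Rightarrow> state \<Rightarrow> bool" where
  "levels_are r s \<longleftrightarrow> (\<forall>k<m. s Rlev k = r (edge_at s k))"

lemma table_cong: "(\<And>r. r \<in> {0, 1, Rm, RA, RB, RrankA, RrankB, Rlq, Ruq} \<Longrightarrow> s' r = s r) \<Longrightarrow> table s' \<longleftrightarrow> table s"
  by (simp add: table_def rankA_ok_def rankB_ok_def edge_at_def[abs_def])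

lemma table_m: "table s \<Longrightarrow> s Rm 0 = m"
  by (auto simp: table_def dest: bij_betw_same_card)

lemma table_T: "table s \<Longrightarrow> s 0 0 = T"
  by (simp add: table_def input_simps)

lemma table_bij: "table s \<Longrightarrow> bij_betw (edge_at s) {..<m} (edges G)"
  using table_m by (auto simp: table_def)

lemma table_edge: "table s \<Longrightarrow> k < m \<Longrightarrow> (s RA k, s RB k) \<in> edges G"
  using table_bij[of s] by (auto simp: bij_betw_def edge_at_def)

lemma table_prefers_A:
  assumes s: "table s" and k: "k < m" "k' < m" and eq: "s RA k' = s RA k"
  shows "prefers G (s RA k) (s RB k') (s RB k) \<longleftrightarrow> s RrankA k' < s RrankA k"
proof -
  have ok: "rankA_ok s k" "rankA_ok s k'" using s k table_m[OF s] by (auto simp: table_def)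
  have "s RA k \<in> verts G" using table_edge[OF s k(1)] edge_verts by blast
  from prefers_nth_iff[OF this, of "s RrankA k'" "s RrankA k"] ok eq
  show ?thesis by (simp add: rankA_ok_def)
qed

lemma table_prefers_B:
  assumes s: "table s" and k: "k < m" "k' < m" and eq: "s RB k' = s RB k"
  shows "prefers G (s RB k) (s RA k') (s RA k) \<longleftrightarrow> s RrankB k' < s RrankB k"
proof -
  have ok: "rankB_ok s k" "rankB_ok s k'" using s k table_m[OF s] by (auto simp: table_def)
  have "s RB k \<in> verts G" using table_edge[OF s k(1)] edge_verts by blast
  from prefers_nth_iff[OF this, of "s RrankB k'" "s RrankB k"] ok eq
  show ?thesis by (simp add: rankB_ok_def)
qed

lemma card_better_A:
  assumes s: "table s" and r: "levels_are r s" and h: "h < m"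
  defines "a \<equiv> s RA h" and "b \<equiv> s RB h"
  shows "card {k. k < m \<and> s RA k = s RA h \<and>
      (s Rlev k < s Rlev h \<or> s Rlev k = s Rlev h \<and> s RrankA k < s RrankA h)}
    = card {b'. (a, b') \<in> edges G \<and> better G a (r (a, b')) b' (r (a, b)) b}"
proof -
  define P where "P p \<longleftrightarrow> fst p = a \<and> better G a (r p) (snd p) (r (a, b)) b" for p
  have "{k. k < m \<and> s RA k = s RA h \<and>
      (s Rlev k < s Rlev h \<or> s Rlev k = s Rlev h \<and> s RrankA k < s RrankA h)}
    = {k. k < m \<and> P (edge_at s k)}"
    using r h table_prefers_A[OF s h]
    by (auto simp: P_def better_def levels_are_def edge_at_def a_def b_def)
  moreover have "{p \<in> edges G. P p} = Pair a ` {b'. (a, b') \<in> edges G \<and> better G a (r (a, b')) b' (r (a, b)) b}"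
    by (auto simp: P_def)
  ultimately show ?thesis
    using card_indices[OF table_bij[OF s], of P] by (simp add: card_image inj_on_def)
qed

text \<open>Offered edges have levels below \<open>2 * T\<close>, and there the truncated
  \<open>2 * T - 1 - r p\<close> strictly reverses the order. This is the reason for
  \<open>e_off\<close>.\<close>

lemma card_better_B:
  assumes s: "table s" and r: "levels_are r s" and e: "e < m"
  defines "a \<equiv> s RA e" and "b \<equiv> s RB e"
  assumes off: "\<And>k. k < m \<Longrightarrow> s Roff k = (if edge_at s k \<in> offered G T r then 1 else 0)"
    and e_off: "(a, b) \<in> offered G T r"
  shows "card {k. k < m \<and> s RB k = s RB e \<and> s Roff k = 1 \<and>
      (s Rlev e < s Rlev k \<or> s Rlev k = s Rlev e \<and> s RrankB k < s RrankB e)}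
    = card (offers_above G T r b (r (a, b)) a)"
proof -
  define P where "P p \<longleftrightarrow> p \<in> offered G T r \<and> snd p = b \<and>
    better G b (2 * T - 1 - r p) (fst p) (2 * T - 1 - r (a, b)) a" for p
  have lt: "r p < 2 * T" if "p \<in> offered G T r" for p
    using that by (auto simp: offered_def)
  have "s RB k = s RB e \<and> s Roff k = 1 \<and>
      (s Rlev e < s Rlev k \<or> s Rlev k = s Rlev e \<and> s RrankB k < s RrankB e) \<longleftrightarrow> P (edge_at s k)"
    if k: "k < m" for k
  proof (cases "edge_at s k \<in> offered G T r \<and> s RB k = b")
    case True
    have lev: "s Rlev k = r (edge_at s k)" "s Rlev e = r (a, b)"
      using r k e by (auto simp: levels_are_def edge_at_def a_def b_def)
    have "prefers G b (fst (edge_at s k)) a \<longleftrightarrow> s RrankB k < s RrankB e"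
      using True table_prefers_B[OF s e k] by (simp add: a_def b_def edge_at_def)
    then show ?thesis
      using True lev lt[of "edge_at s k"] lt[OF e_off] off[OF k]
      by (auto simp: P_def better_def edge_at_def b_def)
  next
    case False
    then show ?thesis using off[OF k] by (auto simp: P_def b_def edge_at_def)
  qed
  then have "{k. k < m \<and> s RB k = s RB e \<and> s Roff k = 1 \<and>
      (s Rlev e < s Rlev k \<or> s Rlev k = s Rlev e \<and> s RrankB k < s RrankB e)}
    = {k. k < m \<and> P (edge_at s k)}" by blast
  moreover have "{p \<in> edges G. P p} = (\<lambda>a'. (a', b)) ` offers_above G T r b (r (a, b)) a"
    using offered_edges by (auto simp: P_def offers_above_def)
  ultimately show ?thesis
    using card_indices[OF table_bij[OF s], of P] by (simp add: card_image inj_on_def)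
qed

lemma wp_compute_offers:
  assumes s: "table s" and r: "levels_are r s"
  shows "wp compute_offers (\<lambda>t s'. t \<le> m * ((m * 4 + 5) + 2) + 2 \<and>
    ((\<forall>q. q \<notin> {Rk, Rcnt, Rh, Roff} \<longrightarrow> s' q = s q) \<and>
      (\<forall>k<m. s' Roff k = (if edge_at s k \<in> offered G T r then 1 else 0)))) s"
proof -
  define I where "I h s' \<longleftrightarrow> (\<forall>q. q \<notin> {Rk, Rcnt, Rh, Roff} \<longrightarrow> s' q = s q) \<and>
      (\<forall>k<h. s' Roff k = (if edge_at s k \<in> offered G T r then 1 else 0))" for h s'
  have "wp compute_offers (\<lambda>t s'. t \<le> m * ((m * 4 + 5) + 2) + 2 \<and> I m s' \<and> s' Rh 0 = m) s"
    unfolding compute_offers_def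
  proof (rule wp_For)
    show "I 0 (update s Rh 0 0)" by (simp add: I_def update_def)
    show "aval (var Rm) s' = m" if "I k s'" for k s'
      using that table_m[OF s] by (simp add: I_def)
    fix h s1 assume h: "h < m" and I: "I h s1" and sh: "s1 Rh 0 = h"
    have eqs: "s1 Rlev = s Rlev" "s1 RA = s RA" "s1 RB = s RB" "s1 RrankA = s RrankA"
      "s1 Rm = s Rm" "s1 0 = s 0" "s1 Ruq = s Ruq" "s1 Rlq = s Rlq"
      using I by (simp_all add: I_def)
    define P where "P k \<longleftrightarrow> s RA k = s RA h \<and>
      (s Rlev k < s Rlev h \<or> s Rlev k = s Rlev h \<and> s RrankA k < s RrankA h)" for k
    have cnt: "wp count_at_A (\<lambda>t s'. t \<le> m * 4 + 3 \<and> s' Rcnt 0 = card {k. k < m \<and> P k} \<and>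
        (\<forall>q. q \<notin> {Rk, Rcnt} \<longrightarrow> s' q = s1 q)) s1"
      unfolding count_at_A_def
      by (rule wp_Count) (use table_m[OF s] sh in \<open>auto simp: eqs P_def\<close>)
    define a b where "a = s RA h" and "b = s RB h"
    have card: "card {k. k < m \<and> P k}
        = card {b'. (a, b') \<in> edges G \<and> better G a (r (a, b')) b' (r (a, b)) b}"
      unfolding P_def a_def b_def by (rule card_better_A[OF s r h])
    have ab: "(a, b) \<in> edges G" "edge_at s h = (a, b)" "a \<in> verts G"
      using table_edge[OF s h] edge_verts by (auto simp: a_def b_def edge_at_def)
    have lev: "s Rlev h = r (a, b)" using r h ab by (simp add: levels_are_def)
    have quotas: "s Rlq a = lquota G a" "s Ruq a = uquota G a" using s ab by (auto simp: table_def)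
    show "wp (Seq count_at_A
        (If is_offered (Assign Roff (var Rh) (Const 1)) (Assign Roff (var Rh) (Const 0))))
      (\<lambda>u s'. u \<le> m * 4 + 5 \<and> s' Rh 0 = h \<and> I (Suc h) (update s' Rh 0 (Suc h))) s1"
      unfolding wp_Seq
    proof (rule wp_mono[OF cnt], elim conjE)
      fix t s2 assume t: "t \<le> m * 4 + 3" and c: "s2 Rcnt 0 = card {k. k < m \<and> P k}"
        and fr: "\<forall>q. q \<notin> {Rk, Rcnt} \<longrightarrow> s2 q = s1 q"
      have "bval is_offered s2 \<longleftrightarrow> (a, b) \<in> offered G T r"
        using fr sh c card lev quotas ab table_T[OF s]
        by (auto simp: is_offered_def eqs offered_def capacity_def a_def[symmetric] not_less)
      moreover have "I (Suc h) (update (update s2 Roff h (if (a, b) \<in> offered G T r then 1 else 0)) Rh 0 (Suc h))"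
        using I fr ab by (auto simp: I_def update_def less_Suc_eq)
      ultimately show "wp (If is_offered (Assign Roff (var Rh) (Const 1)) (Assign Roff (var Rh) (Const 0)))
        (\<lambda>t'. (\<lambda>u s'. u \<le> m * 4 + 5 \<and> s' Rh 0 = h \<and> I (Suc h) (update s' Rh 0 (Suc h))) (t + t')) s2"
        using t fr sh by (auto simp: update_def)
    qed
  qed
  then show ?thesis by (rule wp_mono) (auto simp: I_def)
qed

lemma wp_reject_step:
  assumes s: "table s" and r: "levels_are r s" and e: "s Re 0 = k" "k < m"
  shows "wp reject_step (\<lambda>t s'. t \<le> m * ((m * 4 + 5) + 2) + 2 + (m * 4 + 5) \<and>
    ((\<forall>q. q \<notin> {Rk, Rcnt, Rh, Roff, Rlev} \<longrightarrow> s' q = s q) \<and>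
      levels_are (if edge_at s k \<in> rejected G T r then r(edge_at s k := Suc (r (edge_at s k))) else r) s')) s"
  unfolding reject_step_def
proof (rule wp_SeqI[OF wp_compute_offers[OF s r]], elim conjE)
  fix s1 assume fr: "\<forall>q. q \<notin> {Rk, Rcnt, Rh, Roff} \<longrightarrow> s1 q = s q"
    and off: "\<forall>k<m. s1 Roff k = (if edge_at s k \<in> offered G T r then 1 else 0)"
  have eqs: "s1 Rlev = s Rlev" "s1 RA = s RA" "s1 RB = s RB" "s1 RrankB = s RrankB"
    "s1 Rm = s Rm" "s1 0 = s 0" "s1 Ruq = s Ruq" "s1 Rlq = s Rlq" "s1 Re = s Re"
    using fr by simp_all
  have edge: "edge_at s1 = edge_at s" by (simp add: edge_at_def[abs_def] eqs)
  have s1: "table s1" using s fr by (subst table_cong[of s1 s]) auto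
  have r1: "levels_are r s1" using r by (simp add: levels_are_def eqs edge)
  define P where "P j \<longleftrightarrow> s1 RB j = s1 RB k \<and> s1 Roff j = 1 \<and>
      (s1 Rlev k < s1 Rlev j \<or> s1 Rlev j = s1 Rlev k \<and> s1 RrankB j < s1 RrankB k)" for j
  have cnt: "wp count_at_B (\<lambda>t s'. t \<le> m * 4 + 3 \<and> s' Rcnt 0 = card {j. j < m \<and> P j} \<and>
      (\<forall>q. q \<notin> {Rk, Rcnt} \<longrightarrow> s' q = s1 q)) s1"
    unfolding count_at_B_def
    by (rule wp_Count) (use table_m[OF s] e in \<open>auto simp: eqs P_def\<close>)
  define a b where "a = s RA k" and "b = s RB k"
  have ab: "(a, b) \<in> edges G" "edge_at s k = (a, b)" "b \<in> verts G"
    using table_edge[OF s e(2)] edge_verts by (auto simp: a_def b_def edge_at_def)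
  have lev: "s Rlev k = r (a, b)" using r e ab by (simp add: levels_are_def)
  have quotas: "s Rlq b = lquota G b" "s Ruq b = uquota G b" using s ab by (auto simp: table_def)
  have card: "card {j. j < m \<and> P j} = card (offers_above G T r b (r (a, b)) a)"
    if "(a, b) \<in> offered G T r"
    using card_better_B[OF s1 r1 e(2)] off that unfolding P_def by (simp add: eqs edge a_def b_def)
  let ?r = "if (a, b) \<in> rejected G T r then r((a, b) := Suc (r (a, b))) else r"
  show "wp (Seq count_at_B (If is_rejected (Assign Rlev (var Re) (Plus (entry Rlev Re) (Const 1))) Skip))
    (\<lambda>t s'. t \<le> m * 4 + 5 \<and> ((\<forall>q. q \<notin> {Rk, Rcnt, Rh, Roff, Rlev} \<longrightarrow> s' q = s q) \<and>
      levels_are (if edge_at s k \<in> rejected G T r then r(edge_at s k := Suc (r (edge_at s k))) else r) s')) s1"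
    unfolding wp_Seq ab(2)
  proof (rule wp_mono[OF cnt], elim conjE)
    fix t s2 assume t: "t \<le> m * 4 + 3" and c: "s2 Rcnt 0 = card {j. j < m \<and> P j}"
      and fr2: "\<forall>q. q \<notin> {Rk, Rcnt} \<longrightarrow> s2 q = s1 q"
    have off_k: "s1 Roff k = 1 \<longleftrightarrow> (a, b) \<in> offered G T r" using off e ab by simp
    have rej: "bval is_rejected s2 \<longleftrightarrow> (a, b) \<in> rejected G T r"
    proof (cases "(a, b) \<in> offered G T r")
      case True
      then have "r (a, b) < 2 * T" by (simp add: offered_def)
      then have "T < r (a, b) + 2 \<longleftrightarrow> 2 * T - 1 - r (a, b) \<le> T" by auto
      then show ?thesis
        using True fr2 e c card lev quotas ab table_T[OF s] off_k
        by (auto simp: is_rejected_def eqs rejected_def capacity_def b_def[symmetric])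
    next
      case False
      then have "s1 Roff k = 0" using off e ab by simp
      then show ?thesis
        using False fr2 e rejected_offered by (auto simp: is_rejected_def eqs)
    qed
    \<comment> \<open>No edge has two numbers, so changing one cell of \<open>Rlev\<close> amounts
      to changing \<open>r\<close> at one edge.\<close>
    have inj: "edge_at s j = (a, b) \<longleftrightarrow> j = k" if "j < m" for j
      using table_bij[OF s] that e ab by (auto simp: bij_betw_def inj_on_def)
    show "wp (If is_rejected (Assign Rlev (var Re) (Plus (entry Rlev Re) (Const 1))) Skip)
      (\<lambda>t'. (\<lambda>t s'. t \<le> m * 4 + 5 \<and> ((\<forall>q. q \<notin> {Rk, Rcnt, Rh, Roff, Rlev} \<longrightarrow> s' q = s q) \<and>
        levels_are ?r s')) (t + t')) s2"
    proof (cases "(a, b) \<in> rejected G T r")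
      case True
      have "levels_are ?r (update s2 Rlev k (Suc (s Rlev k)))"
        using True r fr2 lev inj by (auto simp: levels_are_def update_def edge_at_def eqs)
      then show ?thesis
        using True rej fr fr2 t e by (simp add: update_def eqs)
    next
      case False
      have "levels_are ?r s2"
        using False r fr2 by (auto simp: levels_are_def edge_at_def eqs)
      then show ?thesis
        using False rej fr fr2 t by simp
    qed
  qed
qed

text \<open>\<open>n\<close> counts the completed rounds over all edges, \<open>k\<close> the steps of the current round.  Each
  round that starts before the rejections stop raises the sum of the levels.\<close>

definition progress :: "nat \<Rightarrow> nat \<Rightarrow> state \<Rightarrow> bool" where
  "progress n k s \<longleftrightarrow> table s \<and> (\<exists>r. levels_are r s \<and> admissible G T r \<and>
     (rejected G T r = {} \<or> n < (\<Sum>e\<in>edges G. r e) \<or>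
      n \<le> (\<Sum>e\<in>edges G. r e) \<and> (\<forall>k'<k. edge_at s k' \<notin> rejected G T r)))"

lemma progress_update:
  assumes "q \<notin> {0, 1, Rm, RA, RB, RrankA, RrankB, Rlq, Ruq, Rlev}"
  shows "progress n k (update s q i x) \<longleftrightarrow> progress n k s"
proof -
  have eq: "update s q i x r = s r" if "r \<noteq> q" for r using that by (simp add: update_def)
  have "table (update s q i x) \<longleftrightarrow> table s"
    using assms by (intro table_cong eq) auto
  moreover have "edge_at (update s q i x) = edge_at s" "levels_are r (update s q i x) \<longleftrightarrow> levels_are r s" for r
    using assms by (auto simp: levels_are_def edge_at_def[abs_def] eq)
  ultimately show ?thesis by (simp add: progress_def)
qed

lemma update_other: "r \<noteq> q \<Longrightarrow> update s q i x r = s r"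
  by (simp add: update_def)

text \<open>After \<open>m\<close> steps the last alternative says that no edge at all is rejected,
  and \<open>n < sum\<close> is the same as \<open>Suc n \<le> sum\<close>, which starts the next
  round.\<close>

lemma progress_round: "progress n m s \<Longrightarrow> progress (Suc n) 0 s"
proof -
  assume p: "progress n m s"
  then have s: "table s" by (simp add: progress_def)
  have "rejected G T r = {}" if "\<forall>k<m. edge_at s k \<notin> rejected G T r" for r
  proof (rule equals0I)
    fix e assume e: "e \<in> rejected G T r"
    then have "e \<in> edges G" using rejected_offered offered_edges by blast
    then have "e \<in> edge_at s ` {..<m}" using table_bij[OF s] by (simp add: bij_betw_def)
    then show False using that e by auto
  qed
  then show ?thesis using p by (auto simp: progress_def Suc_le_eq)
qed

text \<open>A rejection raises the sum from at least \<open>n\<close> to more than \<open>n\<close>.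
  Without one the levels, and with them the rejected set, stay as they are, and edge
  \<open>k\<close> joins the edges found in order.\<close>

lemma progress_step:
  assumes p: "progress n k s" and k: "k < m" and e: "s Re 0 = k"
  shows "wp reject_step (\<lambda>t s'. t \<le> m * ((m * 4 + 5) + 2) + 2 + (m * 4 + 5) \<and>
    ((\<forall>q. q \<notin> {Rk, Rcnt, Rh, Roff, Rlev} \<longrightarrow> s' q = s q) \<and> progress n (Suc k) s')) s"
proof -
  obtain r where s: "table s" and r: "levels_are r s" and adm: "admissible G T r"
    and pr: "rejected G T r = {} \<or> n < (\<Sum>e\<in>edges G. r e) \<or>
      n \<le> (\<Sum>e\<in>edges G. r e) \<and> (\<forall>k'<k. edge_at s k' \<notin> rejected G T r)"
    using p by (auto simp: progress_def)
  let ?e = "edge_at s k"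
  let ?r = "if ?e \<in> rejected G T r then r(?e := Suc (r ?e)) else r"
  have eG: "?e \<in> edges G" using table_edge[OF s k] by (simp add: edge_at_def)
  have "progress n (Suc k) s'"
    if fr: "\<forall>q. q \<notin> {Rk, Rcnt, Rh, Roff, Rlev} \<longrightarrow> s' q = s q" and lev: "levels_are ?r s'" for s'
  proof -
    have s': "table s'" using s fr by (subst table_cong[of s' s]) auto
    have edge: "edge_at s' = edge_at s" using fr by (simp add: edge_at_def[abs_def])
    show ?thesis
    proof (cases "?e \<in> rejected G T r")
      case True
      then have "n < (\<Sum>e\<in>edges G. ?r e)"
        using pr sum_raise[OF eG, of r] by auto
      then show ?thesis
        using s' lev True admissible_raise[OF adm True] unfolding progress_def
        by (intro conjI exI[of _ ?r]) simp_all
    next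
      case False
      then show ?thesis
        using s' lev adm pr edge unfolding progress_def by (auto simp: less_Suc_eq)
    qed
  qed
  then show ?thesis
    by (intro wp_time_mono[OF wp_reject_step[OF s r e k] order_refl]) auto
qed

definition round_time :: nat where
  "round_time = T * ((T * ((T * 4 + 5) + 2) + 2 + (T * 4 + 5)) + 2) + 2"

lemma m_le: "m \<le> T" "2 * m + 1 < T"
  by (auto simp: size_in_eq)

lemma wp_round:
  assumes p: "progress n 0 s"
  shows "wp (For Re (var Rm) reject_step) (\<lambda>t s'. t \<le> round_time \<and>
    (progress (Suc n) 0 s' \<and> s' Rx = s Rx \<and> s' Ry = s Ry)) s"
proof -
  define I where "I k s' \<longleftrightarrow> progress n k s' \<and> s' Rx = s Rx \<and> s' Ry = s Ry" for k s'
  have "wp (For Re (var Rm) reject_step)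
      (\<lambda>t s'. t \<le> m * ((m * ((m * 4 + 5) + 2) + 2 + (m * 4 + 5)) + 2) + 2 \<and> I m s' \<and> s' Re 0 = m) s"
  proof (rule wp_For)
    show "I 0 (update s Re 0 0)"
      using p by (simp add: I_def progress_update update_other)
    show "aval (var Rm) s' = m" if "I k s'" for k s'
      using that table_m by (auto simp: I_def progress_def)
    show "wp reject_step (\<lambda>u s'. u \<le> m * ((m * 4 + 5) + 2) + 2 + (m * 4 + 5) \<and> s' Re 0 = k \<and>
        I (Suc k) (update s' Re 0 (Suc k))) s1"
      if k: "k < m" "I k s1" "s1 Re 0 = k" for k s1
    proof -
      have "progress n k s1" using k by (simp add: I_def)
      note step = progress_step[OF this k(1,3)]
      show ?thesis
      proof (rule wp_mono[OF step], elim conjE)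
        fix t s' assume "\<forall>q. q \<notin> {Rk, Rcnt, Rh, Roff, Rlev} \<longrightarrow> s' q = s1 q" "progress n (Suc k) s'"
          "t \<le> m * ((m * 4 + 5) + 2) + 2 + (m * 4 + 5)"
        then show "t \<le> m * ((m * 4 + 5) + 2) + 2 + (m * 4 + 5) \<and> s' Re 0 = k \<and>
            I (Suc k) (update s' Re 0 (Suc k))"
          using k by (simp add: I_def progress_update update_other)
      qed
    qed
  qed
  moreover have "m * ((m * ((m * 4 + 5) + 2) + 2 + (m * 4 + 5)) + 2) + 2 \<le> round_time"
    unfolding round_time_def using m_le(1) by (intro add_mono mult_mono) auto
  ultimately show ?thesis
    by (rule wp_time_mono) (auto simp: I_def progress_round)
qed

lemma wp_reject_loop:
  assumes p: "progress 0 0 s"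
  shows "wp reject_loop (\<lambda>t s'. t \<le> 2 * T * ((T * (round_time + 2) + 2) + 2) + 2 \<and>
    (table s' \<and> (\<exists>r. levels_are r s' \<and> admissible G T r \<and> rejected G T r = {}))) s"
proof -
  define I where "I x s \<longleftrightarrow> progress (x * T) 0 s" for x s
  have "wp reject_loop (\<lambda>t s'. t \<le> 2 * T * ((T * (round_time + 2) + 2) + 2) + 2 \<and> I (2 * T) s' \<and> s' Rx 0 = 2 * T) s"
    unfolding reject_loop_def
  proof (rule wp_For)
    show "I 0 (update s Rx 0 0)"
      using p by (simp add: I_def progress_update)
    show "aval (Plus (var 0) (var 0)) s' = 2 * T" if "I k s'" for k s'
      using that table_T by (auto simp: I_def progress_def)
    fix x s1 assume I: "I x s1" and sx: "s1 Rx 0 = x"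
    define J where "J y s' \<longleftrightarrow> progress (x * T + y) 0 s' \<and> s' Rx 0 = x" for y s'
    have "wp (For Ry (var 0) (For Re (var Rm) reject_step))
        (\<lambda>t s'. t \<le> T * (round_time + 2) + 2 \<and> J T s' \<and> s' Ry 0 = T) s1"
    proof (rule wp_For)
      show "J 0 (update s1 Ry 0 0)"
        using I sx by (simp add: I_def J_def progress_update update_other)
      show "aval (var 0) s' = T" if "J k s'" for k s'
        using that table_T by (auto simp: J_def progress_def)
      show "wp (For Re (var Rm) reject_step)
          (\<lambda>u s'. u \<le> round_time \<and> s' Ry 0 = y \<and> J (Suc y) (update s' Ry 0 (Suc y))) s2"
        if y: "J y s2" "s2 Ry 0 = y" for y s2
      proof -
        have "progress (x * T + y) 0 s2" using y by (simp add: J_def)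
        note round = wp_round[OF this]
        show ?thesis
        proof (rule wp_mono[OF round], elim conjE)
          fix t s' assume "t \<le> round_time" "progress (Suc (x * T + y)) 0 s'" "s' Rx = s2 Rx" "s' Ry = s2 Ry"
          then show "t \<le> round_time \<and> s' Ry 0 = y \<and> J (Suc y) (update s' Ry 0 (Suc y))"
            using y by (simp add: J_def progress_update update_other)
        qed
      qed
    qed
    then show "wp (For Ry (var 0) (For Re (var Rm) reject_step))
        (\<lambda>u s'. u \<le> T * (round_time + 2) + 2 \<and> s' Rx 0 = x \<and> I (Suc x) (update s' Rx 0 (Suc x))) s1"
    proof (rule wp_mono, elim conjE)
      fix t s' assume "t \<le> T * (round_time + 2) + 2" "J T s'"
      then show "t \<le> T * (round_time + 2) + 2 \<and> s' Rx 0 = x \<and> I (Suc x) (update s' Rx 0 (Suc x))"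
        by (simp add: I_def J_def progress_update add.commute)
    qed
  qed
  then show ?thesis
  proof (rule wp_mono, elim conjE)
    fix t s' assume t: "t \<le> 2 * T * ((T * (round_time + 2) + 2) + 2) + 2" and "I (2 * T) s'"
    then obtain r where s': "table s'" and r: "levels_are r s'" "admissible G T r"
      and pr: "rejected G T r = {} \<or> 2 * T * T \<le> (\<Sum>e\<in>edges G. r e)"
      by (auto simp: I_def progress_def)
    \<comment> \<open>The sum of the levels never exceeds \<open>2 * T * m\<close>, so it cannot
      have kept pace with all \<open>2 * T * T\<close> rounds.\<close>
    have "2 * T * m < 2 * T * T" using m_le by (intro mult_strict_left_mono) auto
    then have "\<not> 2 * T * T \<le> (\<Sum>e\<in>edges G. r e)" using sum_admissible_le[OF r(2)] by linarith
    then have "rejected G T r = {}" using pr by blast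
    then show "t \<le> 2 * T * ((T * (round_time + 2) + 2) + 2) + 2 \<and>
        (table s' \<and> (\<exists>r. levels_are r s' \<and> admissible G T r \<and> rejected G T r = {}))"
      using t s' r by blast
  qed
qed

lemma wp_write_offers:
  assumes s: "table s" and M: "M \<subseteq> edges G"
    and off: "\<forall>k<m. s Roff k = (if edge_at s k \<in> M then 1 else 0)"
  shows "wp write_offers (\<lambda>t s'. t \<le> m * (4 + 2) + 2 \<and> encodes_edges (read_output s') M) s"
proof -
  define es where "es k = map (edge_at s) (filter (\<lambda>j. edge_at s j \<in> M) [0..<k])" for k
  define L where "L k = concat (map (\<lambda>(a, b). [a, b]) (es k))" for k
  define I where "I k s' \<longleftrightarrow> (\<forall>q. q \<notin> {1, Rk} \<longrightarrow> s' q = s q) \<and> s' 1 0 = length (L k) \<and>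
    (\<forall>i<length (L k). s' 1 (Suc i) = L k ! i)" for k s'
  have "wp write_offers (\<lambda>t s'. t \<le> m * (4 + 2) + 2 \<and> I m s' \<and> s' Rk 0 = m) s"
    unfolding write_offers_def
  proof (rule wp_For)
    show "I 0 (update s Rk 0 0)"
      using s by (simp add: I_def L_def es_def update_def table_def)
    show "aval (var Rm) s' = m" if "I k s'" for k s'
      using that table_m[OF s] by (simp add: I_def)
    fix k s1 assume k: "k < m" and I: "I k s1" and sk: "s1 Rk 0 = k"
    have eqs: "s1 Roff = s Roff" "s1 RA = s RA" "s1 RB = s RB" using I by (simp_all add: I_def)
    let ?out = "update (update (update s1 1 (length (L k) + 1) (s RA k)) 1 (length (L k) + 2) (s RB k))
      1 0 (length (L k) + 2)"
    show "wp (If (Eq (entry Roff Rk) (Const 1))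
        (Seq (Assign 1 (Plus (var 1) (Const 1)) (entry RA Rk))
        (Seq (Assign 1 (Plus (var 1) (Const 2)) (entry RB Rk)) (incr 1 2))) Skip)
      (\<lambda>u s'. u \<le> 4 \<and> s' Rk 0 = k \<and> I (Suc k) (update s' Rk 0 (Suc k))) s1"
    proof (cases "edge_at s k \<in> M")
      case True
      then have "L (Suc k) = L k @ [s RA k, s RB k]"
        by (simp add: L_def es_def edge_at_def)
      then have "I (Suc k) (update ?out Rk 0 (Suc k))"
        using I by (auto simp: I_def update_def nth_append less_Suc_eq)
      moreover have "s1 1 0 = length (L k)" using I by (simp add: I_def)
      ultimately show ?thesis
        using True off k sk by (simp add: eqs update_def)
    next
      case False
      then have "L (Suc k) = L k" by (simp add: L_def es_def)
      then have "I (Suc k) (update s1 Rk 0 (Suc k))"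
        using I by (simp add: I_def update_def)
      then show ?thesis using False off k sk by (simp add: eqs)
    qed
  qed
  moreover have "encodes_edges (read_output s') M" if I: "I m s'" for s'
    unfolding encodes_edges_def
  proof (intro exI[of _ "es m"] conjI)
    have b: "inj_on (edge_at s) {..<m}" "edge_at s ` {..<m} = edges G"
      using table_bij[OF s] by (auto simp: bij_betw_def)
    show "distinct (es m)"
      unfolding es_def distinct_map by (auto intro: inj_on_subset[OF b(1)])
    show "set (es m) = M"
    proof -
      have "set (es m) = edge_at s ` {..<m} \<inter> M" by (auto simp: es_def)
      then show ?thesis using b(2) M by auto
    qed
    show "read_output s' = concat (map (\<lambda>(a, b). [a, b]) (es m))"
      unfolding L_def[symmetric]
      by (rule nth_equalityI) (use I in \<open>auto simp: read_output_def I_def nth_upt simp del: upt_Suc\<close>)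
  qed
  ultimately show ?thesis by (auto elim: wp_mono)
qed

end

text \<open>Left unsimplified, in the nested form in which the rules for loops and sequences produce
  it; all counts are replaced by the length of the input.\<close>

definition program_time :: "nat \<Rightarrow> nat" where
  "program_time n = 1 + ((n * (5 + (n * 7 + 2) + 2) + 2) +
    ((n * (5 + (n * ((n * 4 + 3) + 2) + 2) + 2) + 2) +
    ((2 * n * ((n * ((n * ((n * ((n * 4 + 5) + 2) + 2 + (n * 4 + 5)) + 2) + 2) + 2) + 2) + 2) + 2) +
    ((n * ((n * 4 + 5) + 2) + 2) + (n * (4 + 2) + 2)))))"

theorem (in encoded_instance) wp_popular_critical_program:
  "wp popular_critical_program (\<lambda>t s. t \<le> program_time T \<and>
    (\<exists>r. admissible G T r \<and> rejected G T r = {} \<and> encodes_edges (read_output s) (offered G T r)))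
    (init_state (encode_graph G))"
  unfolding popular_critical_program_def program_time_def
proof (rule wp_SeqI)
  let ?s = "init_state (encode_graph G)"
  show "wp (assign Rpos (Const 3)) (\<lambda>t s'. t \<le> 1 \<and> (parsed {} {} s' \<and> s' Rpos 0 = 3)) ?s"
    by (auto simp: update_def parsed_def input_def init_state_def bij_betw_def)
next
  fix s assume "parsed {} {} s \<and> s Rpos 0 = 3"
  then have A: "wp read_sideA (\<lambda>t s'. t \<le> T * (5 + (T * 7 + 2) + 2) + 2 \<and>
      (parsed (edges G) (sideA G) s' \<and> s' Rpos 0 = offset (length as))) s"
    by (intro wp_read_sideA) auto
  show "wp (Seq read_sideA (Seq read_sideB (Seq reject_loop (Seq compute_offers write_offers))))
    (\<lambda>t s. t \<le> (T * (5 + (T * 7 + 2) + 2) + 2) +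
      ((T * (5 + (T * ((T * 4 + 3) + 2) + 2) + 2) + 2) +
      ((2 * T * ((T * ((T * ((T * ((T * 4 + 5) + 2) + 2 + (T * 4 + 5)) + 2) + 2) + 2) + 2) + 2) + 2) +
      ((T * ((T * 4 + 5) + 2) + 2) + (T * (4 + 2) + 2)))) \<and>
      (\<exists>r. admissible G T r \<and> rejected G T r = {} \<and> encodes_edges (read_output s) (offered G T r))) s"
  proof (rule wp_SeqI[OF A], rule wp_SeqI[OF wp_read_sideB])
    fix s assume "table s \<and> s Rlev = (\<lambda>_. 0)"
    then have "progress 0 0 s"
      using admissible_zero by (auto simp: progress_def levels_are_def intro!: exI[of _ "\<lambda>_. 0"])
    note loop = wp_reject_loop[OF this, unfolded round_time_def]
    show "wp (Seq reject_loop (Seq compute_offers write_offers))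
      (\<lambda>t s. t \<le> (2 * T * ((T * ((T * ((T * ((T * 4 + 5) + 2) + 2 + (T * 4 + 5)) + 2) + 2) + 2) + 2) + 2) + 2) +
        ((T * ((T * 4 + 5) + 2) + 2) + (T * (4 + 2) + 2)) \<and>
        (\<exists>r. admissible G T r \<and> rejected G T r = {} \<and> encodes_edges (read_output s) (offered G T r))) s"
    proof (rule wp_SeqI[OF loop], elim conjE exE)
      fix s r assume s: "table s" and r: "levels_are r s" "admissible G T r" "rejected G T r = {}"
      have "wp (Seq compute_offers write_offers) (\<lambda>t s'. t \<le> (m * ((m * 4 + 5) + 2) + 2) + (m * (4 + 2) + 2) \<and>
          encodes_edges (read_output s') (offered G T r)) s"
      proof (rule wp_SeqI[OF wp_compute_offers[OF s r(1)]], elim conjE)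
        fix s' assume fr: "\<forall>q. q \<notin> {Rk, Rcnt, Rh, Roff} \<longrightarrow> s' q = s q"
          and off: "\<forall>k<m. s' Roff k = (if edge_at s k \<in> offered G T r then 1 else 0)"
        have "table s'" using s fr by (subst table_cong[of s' s]) auto
        moreover have "edge_at s' = edge_at s" using fr by (simp add: edge_at_def[abs_def])
        ultimately show "wp write_offers (\<lambda>t s'. t \<le> m * (4 + 2) + 2 \<and>
            encodes_edges (read_output s') (offered G T r)) s'"
          using off offered_edges by (intro wp_write_offers) auto
      qed
      moreover have "(m * ((m * 4 + 5) + 2) + 2) + (m * (4 + 2) + 2)
          \<le> (T * ((T * 4 + 5) + 2) + 2) + (T * (4 + 2) + 2)"
        using m_le(1) by (intro add_mono mult_mono) auto
      ultimately show "wp (Seq compute_offers write_offers)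
        (\<lambda>t s. t \<le> (T * ((T * 4 + 5) + 2) + 2) + (T * (4 + 2) + 2) \<and>
          (\<exists>r. admissible G T r \<and> rejected G T r = {} \<and> encodes_edges (read_output s) (offered G T r))) s"
        by (rule wp_time_mono) (use r in blast)
    qed
  qed auto
qed

section \<open>Polynomial running time\<close>

definition polynomial :: "(nat \<Rightarrow> nat) \<Rightarrow> bool" where
  "polynomial f \<longleftrightarrow> (\<exists>p. \<forall>x. f x = poly p x)"

lemma polynomial_const: "polynomial (\<lambda>_. c)"
  unfolding polynomial_def by (rule exI[of _ "[:c:]"]) simp

lemma polynomial_id: "polynomial (\<lambda>x. x)"
  unfolding polynomial_def by (rule exI[of _ "[:0, 1:]"]) simp

lemma polynomial_add: "polynomial f \<Longrightarrow> polynomial g \<Longrightarrow> polynomial (\<lambda>x. f x + g x)"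
  unfolding polynomial_def by (metis poly_add)

lemma polynomial_mult: "polynomial f \<Longrightarrow> polynomial g \<Longrightarrow> polynomial (\<lambda>x. f x * g x)"
  unfolding polynomial_def by (metis poly_mult)

lemma polynomial_program_time: "polynomial program_time"
  unfolding program_time_def[abs_def]
  by (intro polynomial_add polynomial_mult polynomial_const polynomial_id)

lemma program_time_mono: "x \<le> y \<Longrightarrow> program_time x \<le> program_time y"
  unfolding program_time_def by (intro add_mono mult_mono) auto

text \<open>Every entry costs at least its separator. No loop runs over the value of a quota or a
  name, so the number of entries alone governs the running time.\<close>

lemma length_le_bit_size: "length xs \<le> bit_size xs"
  by (induction xs) (auto simp: bit_size_def)

theorem theorem1:
  shows "(\<exists>c. solves_in_polynomial_time encode_graph encodes_edges
              {G :: nat quota_graph. bipartite_quota_graph G}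
              (\<lambda>G M. matching G M \<and> critical G M \<and> popular_critical G M \<and>
                     (\<forall>N. matching G N \<and> popular_critical G N \<longrightarrow> card N \<le> card M))
              c) \<and>
         (\<forall>G :: 'v quota_graph. bipartite_quota_graph G \<longrightarrow> (\<exists>M. popular_critical G M))"
proof (intro conjI exI[of _ popular_critical_program] allI impI)
  obtain p where p: "\<And>x. program_time x = poly p x"
    using polynomial_program_time by (auto simp: polynomial_def)
  show "solves_in_polynomial_time encode_graph encodes_edges
      {G :: nat quota_graph. bipartite_quota_graph G}
      (\<lambda>G M. matching G M \<and> critical G M \<and> popular_critical G M \<and>
             (\<forall>N. matching G N \<and> popular_critical G N \<longrightarrow> card N \<le> card M))
      popular_critical_program"
    unfolding solves_in_polynomial_time_def
  proof (intro exI[of _ p] ballI)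
    fix G :: "nat quota_graph" assume "G \<in> {G. bipartite_quota_graph G}"
    then interpret encoded_instance G by unfold_locales simp
    obtain t s r where run: "exec popular_critical_program (init_state (encode_graph G)) t s"
      "t \<le> program_time T" and r: "admissible G T r" "rejected G T r = {}"
      and out: "encodes_edges (read_output s) (offered G T r)"
      using wp_popular_critical_program by (auto simp: wp_def)
    have "t \<le> poly p (bit_size (encode_graph G))"
      using run(2) program_time_mono[OF length_le_bit_size[of "encode_graph G"]]
      unfolding p size_in_def by (rule order.trans)
    then show "\<exists>t s M. exec popular_critical_program (init_state (encode_graph G)) t s \<and>
        t \<le> poly p (bit_size (encode_graph G)) \<and> encodes_edges (read_output s) M \<and>
        matching G M \<and> critical G M \<and> popular_critical G M \<and>
        (\<forall>N. matching G N \<and> popular_critical G N \<longrightarrow> card N \<le> card M)"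
      using run(1) out offered_solution[OF m_le(2) r] by blast
  qed
next
  fix G :: "'v quota_graph" assume "bipartite_quota_graph G"
  then interpret quota_instance G by unfold_locales
  show "\<exists>M. popular_critical G M" by (rule popular_critical_exists)
qed

end
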